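(* For every $t=0,\dots,T$, the function $V_t(\Pi_t)$ defined by the recursion $$V_T(\Pi_T):=\mathbb E^{\mathbf g}\big[c_T(X_T)\mid \Pi_T=\pi_T\big],$$ $$V_t(\Pi_t):=\inf_{u_t^{1:K}\in\prod_{k\in\mathcal K}\mathcal U_t^k}\mathbb E^{\mathbf g}\Big[c_t(X_t,U_t^{1:K})+\beta\,|X_{t+1}-\hat X_{t+1}|^2+V_{t+1}\big(\phi_t[\Pi_t,Y_{t+1}^{1:K},U_t^{1:K}]\big)\ \Big|\ \Pi_t=\pi_t,\ U_t^{1:K}=u_t^{1:K}\Big]$$ is concave with respect to the information state $\Pi_t=\Pi_t(\Delta_t,\Lambda_t^{1:K})(X_t,\hat X_t)$.
   Context: Setting. Fix $K,T\in\mathbb N$, $\mathcal K=\{1,\dots,K\}$, a delay $n\in\mathbb N$, and a probability space. Superscripts index subsystems, subscripts index time; $A^{1:K}_t=(A^1_t,\dots,A^K_t)$, $A_{s:t}=(A_s,\dots,A_t)$ (entries with negative time are absent). Two systems with the same state spaces $(\mathcal X_t,\mathscr X_t)$ are driven by the same control and disturbance: the "CPS model" with state $X_t$ and the "actual CPS" with state $\hat X_t$, $$X_{t+1}=f_t(X_t,U_t^{1:K},W_t),\qquad \hat X_{t+1}=\hat f_t(\hat X_t,U_t^{1:K},W_t),\qquad t=0,\dots,T-1,$$ with $U_t^k$ valued in $\mathcal U_t^k$. Model observations are $Y_t^k=h_t^k(X_t,Z_t^k)\in\mathcal Y^k$, used for $t=0,\dots,T$. The $W_t$ are independent of each other and of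 $(X_0,\hat X_0)$; the $Z_t^k$ are independent of each other, of all $W_t$, and of $(X_0,\hat X_0)$. Model data: $\Delta_t=(Y^{1:K}_{0:t-n},U^{1:K}_{0:t-n})$, $\Lambda_t^k=(Y^k_{t-n+1:t},U^k_{t-n+1:t-1})$. A strategy $\mathbf g=\{g_t\}$ is separated ($\mathbf g\in\mathcal G^s$) if $U_t^{1:K}=g_t(\Pi_t)$ with $\Pi_t$ the information state, i.e. the whole conditional density of $(X_t,\hat X_t)$ given $(\Delta_t,\Lambda_t^{1:K})$, which does not depend on $\mathbf g$. All distributions are assumed to have densities $p(\cdot)$. The costs $c_t:\mathcal X_t\times\prod_k\mathcal U_t^k\to\mathbb R$ ($t<T$), $c_T:\mathcal X_T\to\mathbb R$ are measurable, $\beta$ is a constant scaling factor, $|\cdot|$ is a norm on the state space. Here $p(y\mid x')$ is the density of $Y_{t+1}^{1:K}$ given $X_{t+1}=x'$, $p(x',\hat x'\mid x,\hat x,u)$ is the density of $(X_{t+1},\hat X_{t+1})$ given $X_t=x,\hat X_t=\hat x,U_t^{1:K}=u$, and $\phi_t$ is the Bayes update $\Pi_{t+1}=\phi_t[\Pi_t,Y_{t+1}^{1:K},U_t^{1:K}]$, $$\phi_t[\pi,y,u](x',\hat x')=\frac{p(y\mid x')\iint p(x',\hat x'\mid x,\hat x,u)\,\pi(x,\hat x)\,dx\,d\hat x}{\iint p(y\mid \xi)\iint p(\xi,\hat \xi\mid x,\hat x,u)\,\pi(x,\hat x)\,dx\,d\hat x\,d\xi\,d\hat\xi}.$$ The conditional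 expectation given $\Pi_t=\pi$, $U_t^{1:K}=u$ is the integral with respect to $p(y\mid x')\,p(x',\hat x'\mid x,\hat x,u)\,\pi(x,\hat x)\,dx\,d\hat x\,dx'\,d\hat x'\,dy$ of the bracketed quantity (with $X_t=x$, $\hat X_t=\hat x$, $X_{t+1}=x'$, $\hat X_{t+1}=\hat x'$, $Y_{t+1}^{1:K}=y$), so it does not depend on $\mathbf g$; in particular $V_T(\pi)=\iint c_T(x)\pi(x,\hat x)\,dx\,d\hat x$. Thus $V_t$ is a function on the convex set of densities $\pi$ on $\mathcal X_t\times\mathcal X_t$. *)

theory Defs
  imports "HOL-Probability.Probability"
begin

section \<open>Extended-real expectations\<close>

text \<open>
  Costs are only assumed measurable and the infima in the recursion may be infinite, so
  expectations are taken in the extended reals. The integral exists if the integrand is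
  almost everywhere equal to a measurable function and its positive and negative parts do not
  both have infinite integral.
\<close>

definition ereal_integral_exists :: "'a measure \<Rightarrow> ('a \<Rightarrow> ereal) \<Rightarrow> bool" where
  "ereal_integral_exists M F \<longleftrightarrow>
     (\<exists>G \<in> borel_measurable M. AE z in M. F z = G z) \<and>
     ((\<integral>\<^sup>+ z. e2ennreal (F z) \<partial>M) < \<infinity> \<or> (\<integral>\<^sup>+ z. e2ennreal (- F z) \<partial>M) < \<infinity>)"

definition ereal_integral :: "'a measure \<Rightarrow> ('a \<Rightarrow> ereal) \<Rightarrow> ereal" where
  "ereal_integral M F =
     enn2ereal (\<integral>\<^sup>+ z. e2ennreal (F z) \<partial>M) - enn2ereal (\<integral>\<^sup>+ z. e2ennreal (- F z) \<partial>M)"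

lemma ereal_integral_eq_integral:
  fixes f :: "'a \<Rightarrow> real"
  assumes "integrable M f"
  shows "ereal_integral_exists M (\<lambda>z. ereal (f z))"
    and "ereal_integral M (\<lambda>z. ereal (f z)) = ereal (integral\<^sup>L M f)"
proof -
  have pos: "(\<integral>\<^sup>+ z. ennreal (f z) \<partial>M) < \<infinity>" and neg: "(\<integral>\<^sup>+ z. ennreal (- f z) \<partial>M) < \<infinity>"
    using assms by (auto simp: real_integrable_def top.not_eq_extremum)
  have eq: "e2ennreal (ereal r) = ennreal r" for r
    by (simp add: ennreal.abs_eq e2ennreal_def max_def)
  show "ereal_integral_exists M (\<lambda>z. ereal (f z))"
    unfolding ereal_integral_exists_def
    using assms pos by (auto simp: eq intro!: bexI[of _ "\<lambda>z. ereal (f z)"])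
  obtain a b where ab: "0 \<le> a" "0 \<le> b"
      "(\<integral>\<^sup>+ z. ennreal (f z) \<partial>M) = ennreal a" "(\<integral>\<^sup>+ z. ennreal (- f z) \<partial>M) = ennreal b"
    using pos neg by (metis ennreal_cases infinity_ennreal_def less_irrefl)
  then have "integral\<^sup>L M f = a - b"
    using real_lebesgue_integral_def[OF assms] by simp
  then show "ereal_integral M (\<lambda>z. ereal (f z)) = ereal (integral\<^sup>L M f)"
    using ab by (simp add: ereal_integral_def eq)
qed

section \<open>The coupled system\<close>

text \<open>
  Every measure below carries a measurable space. The measures \<open>state_sp t\<close> and \<open>obs_sp k\<close> are
  in addition the reference measures with respect to which densities are taken (the
  differentials \<open>dx\<close> and \<open>dy\<close>); for \<open>ctrl_sp\<close>, \<open>dist_sp\<close> and \<open>noise_sp\<close> only the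
  \<open>\<sigma>\<close>-algebra matters.
  The actual system shares state spaces, controls and disturbances with the model; its data
  are marked \<open>act\<close>.
\<close>

record ('s, 'x, 'u, 'y, 'w, 'z) cps =
  subsystems :: nat
  horizon :: nat
  sample_sp :: "'s measure"
  state_sp :: "nat \<Rightarrow> 'x measure"
  ctrl_sp :: "nat \<Rightarrow> nat \<Rightarrow> 'u measure"
  obs_sp :: "nat \<Rightarrow> 'y measure"
  dist_sp :: "nat \<Rightarrow> 'w measure"
  noise_sp :: "nat \<Rightarrow> nat \<Rightarrow> 'z measure"
  init :: "'s \<Rightarrow> 'x"
  act_init :: "'s \<Rightarrow> 'x"
  disturbance :: "nat \<Rightarrow> 's \<Rightarrow> 'w"
  noise :: "nat \<Rightarrow> nat \<Rightarrow> 's \<Rightarrow> 'z"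
  dyn :: "nat \<Rightarrow> 'x \<Rightarrow> (nat \<Rightarrow> 'u) \<Rightarrow> 'w \<Rightarrow> 'x"
  act_dyn :: "nat \<Rightarrow> 'x \<Rightarrow> (nat \<Rightarrow> 'u) \<Rightarrow> 'w \<Rightarrow> 'x"
  obs_map :: "nat \<Rightarrow> nat \<Rightarrow> 'x \<Rightarrow> 'z \<Rightarrow> 'y"
  trans_dens :: "nat \<Rightarrow> 'x \<Rightarrow> 'x \<Rightarrow> (nat \<Rightarrow> 'u) \<Rightarrow> 'x \<Rightarrow> 'x \<Rightarrow> ennreal"
  obs_dens :: "nat \<Rightarrow> 'x \<Rightarrow> (nat \<Rightarrow> 'y) \<Rightarrow> ennreal"
  cost :: "nat \<Rightarrow> 'x \<Rightarrow> (nat \<Rightarrow> 'u) \<Rightarrow> real"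
  final_cost :: "'x \<Rightarrow> real"
  scaling :: real

definition pair_sp :: "('s, 'x, 'u, 'y, 'w, 'z) cps \<Rightarrow> nat \<Rightarrow> ('x \<times> 'x) measure" where
  "pair_sp S t = state_sp S t \<Otimes>\<^sub>M state_sp S t"

definition joint_ctrl_sp :: "('s, 'x, 'u, 'y, 'w, 'z) cps \<Rightarrow> nat \<Rightarrow> (nat \<Rightarrow> 'u) measure" where
  "joint_ctrl_sp S t = (\<Pi>\<^sub>M k \<in> {1..subsystems S}. ctrl_sp S t k)"

definition joint_obs_sp :: "('s, 'x, 'u, 'y, 'w, 'z) cps \<Rightarrow> (nat \<Rightarrow> 'y) measure" where
  "joint_obs_sp S = (\<Pi>\<^sub>M k \<in> {1..subsystems S}. obs_sp S k)"

datatype source = Initial | Disturbance nat | Noise nat nat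

definition sources :: "('s, 'x, 'u, 'y, 'w, 'z) cps \<Rightarrow> source set" where
  "sources S = {Initial} \<union> {Disturbance t | t. t < horizon S} \<union>
     {Noise t k | t k. t \<le> horizon S \<and> k \<in> {1..subsystems S}}"

fun source_events :: "('s, 'x, 'u, 'y, 'w, 'z) cps \<Rightarrow> source \<Rightarrow> 's set set" where
  "source_events S Initial =
     {(\<lambda>\<omega>. (init S \<omega>, act_init S \<omega>)) -` A \<inter> space (sample_sp S) | A. A \<in> sets (pair_sp S 0)}"
| "source_events S (Disturbance t) =
     {disturbance S t -` A \<inter> space (sample_sp S) | A. A \<in> sets (dist_sp S t)}"
| "source_events S (Noise t k) =
     {noise S t k -` A \<inter> space (sample_sp S) | A. A \<in> sets (noise_sp S t k)}"

text \<open>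
  The primitive random variables are mutually independent, so the conditional density of the
  next pair of states given the current pair \<open>(x, xh)\<close> and the control \<open>u\<close> is the density of
  the dynamics with \<open>x\<close>, \<open>xh\<close>, \<open>u\<close> held fixed, and likewise for the observations.
\<close>

locale cps_model = prob_space "sample_sp S"
  for S :: "('s, 'x :: real_normed_vector, 'u, 'y, 'w, 'z) cps" +
  assumes state_sigma_finite: "\<And>t. t \<le> horizon S \<Longrightarrow> sigma_finite_measure (state_sp S t)"
    and obs_sigma_finite: "\<And>k. k \<in> {1..subsystems S} \<Longrightarrow> sigma_finite_measure (obs_sp S k)"
    and norm_measurable: "\<And>t. t \<le> horizon S \<Longrightarrow>
      (\<lambda>(x, xh). norm (x - xh)) \<in> borel_measurable (pair_sp S t)"
    and init_distributed: "\<exists>p. distributed (sample_sp S) (pair_sp S 0)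
      (\<lambda>\<omega>. (init S \<omega>, act_init S \<omega>)) p"
    and disturbance_measurable: "\<And>t. t < horizon S \<Longrightarrow>
      disturbance S t \<in> measurable (sample_sp S) (dist_sp S t)"
    and noise_measurable: "\<And>t k. t \<le> horizon S \<Longrightarrow> k \<in> {1..subsystems S} \<Longrightarrow>
      noise S t k \<in> measurable (sample_sp S) (noise_sp S t k)"
    and sources_indep: "indep_sets (source_events S) (sources S)"
    and dyn_measurable: "\<And>t. t < horizon S \<Longrightarrow> (\<lambda>(x, u, w). dyn S t x u w) \<in>
      measurable (state_sp S t \<Otimes>\<^sub>M joint_ctrl_sp S t \<Otimes>\<^sub>M dist_sp S t) (state_sp S (Suc t))"
    and act_dyn_measurable: "\<And>t. t < horizon S \<Longrightarrow> (\<lambda>(x, u, w). act_dyn S t x u w) \<in>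
      measurable (state_sp S t \<Otimes>\<^sub>M joint_ctrl_sp S t \<Otimes>\<^sub>M dist_sp S t) (state_sp S (Suc t))"
    and obs_map_measurable: "\<And>t k. t \<le> horizon S \<Longrightarrow> k \<in> {1..subsystems S} \<Longrightarrow>
      (\<lambda>(x, z). obs_map S t k x z) \<in>
      measurable (state_sp S t \<Otimes>\<^sub>M noise_sp S t k) (obs_sp S k)"
    and trans_dens_measurable: "\<And>t. t < horizon S \<Longrightarrow>
      (\<lambda>((x, xh), u, (x', xh')). trans_dens S t x xh u x' xh') \<in>
      borel_measurable (pair_sp S t \<Otimes>\<^sub>M joint_ctrl_sp S t \<Otimes>\<^sub>M pair_sp S (Suc t))"
    and trans_distributed: "\<And>t x xh u. t < horizon S \<Longrightarrow> x \<in> space (state_sp S t) \<Longrightarrow>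
      xh \<in> space (state_sp S t) \<Longrightarrow> u \<in> space (joint_ctrl_sp S t) \<Longrightarrow>
      distributed (sample_sp S) (pair_sp S (Suc t))
        (\<lambda>\<omega>. (dyn S t x u (disturbance S t \<omega>), act_dyn S t xh u (disturbance S t \<omega>)))
        (\<lambda>(x', xh'). trans_dens S t x xh u x' xh')"
    and obs_dens_measurable: "\<And>t. t \<le> horizon S \<Longrightarrow>
      (\<lambda>(x, y). obs_dens S t x y) \<in> borel_measurable (state_sp S t \<Otimes>\<^sub>M joint_obs_sp S)"
    and obs_distributed: "\<And>t x. t \<le> horizon S \<Longrightarrow> x \<in> space (state_sp S t) \<Longrightarrow>
      distributed (sample_sp S) (joint_obs_sp S)
        (\<lambda>\<omega>. \<lambda>k \<in> {1..subsystems S}. obs_map S t k x (noise S t k \<omega>)) (obs_dens S t x)"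
    and cost_measurable: "\<And>t. t < horizon S \<Longrightarrow>
      (\<lambda>(x, u). cost S t x u) \<in> borel_measurable (state_sp S t \<Otimes>\<^sub>M joint_ctrl_sp S t)"
    and final_cost_measurable: "final_cost S \<in> borel_measurable (state_sp S (horizon S))"

section \<open>Information states and the value functions\<close>

definition info_states :: "('s, 'x, 'u, 'y, 'w, 'z) cps \<Rightarrow> nat \<Rightarrow> ('x \<times> 'x \<Rightarrow> ennreal) set" where
  "info_states S t =
     {\<pi> \<in> borel_measurable (pair_sp S t). (\<integral>\<^sup>+ z. \<pi> z \<partial>pair_sp S t) = 1}"

text \<open>
  If the denominator is \<open>0\<close> or \<open>\<infinity>\<close> the quotient is not a density. For a density \<open>\<pi>\<close> such
  \<open>y\<close> have probability zero and do not affect the recursion.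
\<close>

definition bayes_update ::
  "('s, 'x, 'u, 'y, 'w, 'z) cps \<Rightarrow> nat \<Rightarrow> ('x \<times> 'x \<Rightarrow> ennreal) \<Rightarrow> (nat \<Rightarrow> 'y) \<Rightarrow> (nat \<Rightarrow> 'u)
     \<Rightarrow> 'x \<times> 'x \<Rightarrow> ennreal" where
  "bayes_update S t \<pi> y u = (\<lambda>(x', xh').
     (obs_dens S (Suc t) x' y *
       (\<integral>\<^sup>+ (x, xh). trans_dens S t x xh u x' xh' * \<pi> (x, xh) \<partial>pair_sp S t)) /
     (\<integral>\<^sup>+ (\<xi>, \<xi>h). obs_dens S (Suc t) \<xi> y *
       (\<integral>\<^sup>+ (x, xh). trans_dens S t x xh u \<xi> \<xi>h * \<pi> (x, xh) \<partial>pair_sp S t) \<partial>pair_sp S (Suc t)))"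

text \<open>
  The conditional law of current states, next states and next observations, given the
  information state \<open>\<pi>\<close> and the control \<open>u\<close>.
\<close>

definition step_law ::
  "('s, 'x, 'u, 'y, 'w, 'z) cps \<Rightarrow> nat \<Rightarrow> ('x \<times> 'x \<Rightarrow> ennreal) \<Rightarrow> (nat \<Rightarrow> 'u)
     \<Rightarrow> (('x \<times> 'x) \<times> ('x \<times> 'x) \<times> (nat \<Rightarrow> 'y)) measure" where
  "step_law S t \<pi> u =
     density (pair_sp S t \<Otimes>\<^sub>M pair_sp S (Suc t) \<Otimes>\<^sub>M joint_obs_sp S)
       (\<lambda>((x, xh), (x', xh'), y).
          obs_dens S (Suc t) x' y * trans_dens S t x xh u x' xh' * \<pi> (x, xh))"

function value_fn ::
  "('s, 'x :: real_normed_vector, 'u, 'y, 'w, 'z) cps \<Rightarrow> nat \<Rightarrow> ('x \<times> 'x \<Rightarrow> ennreal) \<Rightarrow> ereal" where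
  "value_fn S t \<pi> =
     (if t < horizon S
      then (INF u \<in> space (joint_ctrl_sp S t).
              ereal_integral (step_law S t \<pi> u)
                (\<lambda>((x, xh), (x', xh'), y).
                   ereal (cost S t x u + scaling S * (norm (x' - xh'))\<^sup>2) +
                   value_fn S (Suc t) (bayes_update S t \<pi> y u)))
      else ereal_integral (density (pair_sp S t) \<pi>) (\<lambda>(x, xh). ereal (final_cost S x)))"
  by pat_completeness auto
termination
  by (relation "Wellfounded.measure (\<lambda>(S, t, \<pi>). horizon S - t)") auto

declare value_fn.simps [simp del]

text \<open>
  The recursion is well posed at \<open>\<pi>\<close> if every expectation occurring in the evaluation of the
  value function at \<open>\<pi>\<close> exists.
\<close>

function well_posed ::
  "('s, 'x :: real_normed_vector, 'u, 'y, 'w, 'z) cps \<Rightarrow> nat \<Rightarrow> ('x \<times> 'x \<Rightarrow> ennreal) \<Rightarrow> bool" where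
  "well_posed S t \<pi> =
     (if t < horizon S
      then (\<forall>u \<in> space (joint_ctrl_sp S t).
              (AE ((x, xh), (x', xh'), y) in step_law S t \<pi> u.
                 well_posed S (Suc t) (bayes_update S t \<pi> y u)) \<and>
              ereal_integral_exists (step_law S t \<pi> u)
                (\<lambda>((x, xh), (x', xh'), y).
                   ereal (cost S t x u + scaling S * (norm (x' - xh'))\<^sup>2) +
                   value_fn S (Suc t) (bayes_update S t \<pi> y u)))
      else ereal_integral_exists (density (pair_sp S t) \<pi>) (\<lambda>(x, xh). ereal (final_cost S x)))"
  by pat_completeness auto
termination
  by (relation "Wellfounded.measure (\<lambda>(S, t, \<pi>). horizon S - t)") auto

declare well_posed.simps [simp del]

section \<open>Concavity\<close>

definition mixture :: "real \<Rightarrow> ('a \<Rightarrow> ennreal) \<Rightarrow> ('a \<Rightarrow> ennreal) \<Rightarrow> 'a \<Rightarrow> ennreal" where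
  "mixture a \<pi> \<rho> = (\<lambda>z. ennreal a * \<pi> z + ennreal (1 - a) * \<rho> z)"

definition convex_densities :: "('a \<Rightarrow> ennreal) set \<Rightarrow> bool" where
  "convex_densities D \<longleftrightarrow>
     (\<forall>\<pi> \<in> D. \<forall>\<rho> \<in> D. \<forall>a \<in> {0..1}. mixture a \<pi> \<rho> \<in> D)"

text \<open>
  The library fixes \<open>\<infinity> + (-\<infinity>) = \<infinity>\<close>, so points with value \<open>-\<infinity>\<close> are excluded from the
  inequality; this is convexity of the hypograph.
\<close>

definition concave_on_densities :: "('a \<Rightarrow> ennreal) set \<Rightarrow> (('a \<Rightarrow> ennreal) \<Rightarrow> ereal) \<Rightarrow> bool" where
  "concave_on_densities D V \<longleftrightarrow> convex_densities D \<and>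
     (\<forall>\<pi> \<in> D. \<forall>\<rho> \<in> D. \<forall>a \<in> {0..1}. V \<pi> \<noteq> -\<infinity> \<longrightarrow> V \<rho> \<noteq> -\<infinity> \<longrightarrow>
        ereal a * V \<pi> + ereal (1 - a) * V \<rho> \<le> V (mixture a \<pi> \<rho>))"

lemma convex_info_states: "convex_densities (info_states S t)"
  unfolding convex_densities_def
proof (intro ballI)
  fix \<pi> \<rho> and a :: real
  assume *: "\<pi> \<in> info_states S t" "\<rho> \<in> info_states S t" "a \<in> {0..1}"
  then have "\<pi> \<in> borel_measurable (pair_sp S t)" "\<rho> \<in> borel_measurable (pair_sp S t)"
    by (auto simp: info_states_def)
  moreover have "ennreal a + ennreal (1 - a) = 1"
    using *(3) by (simp flip: ennreal_plus)
  ultimately show "mixture a \<pi> \<rho> \<in> info_states S t"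
    using * by (auto simp: info_states_def mixture_def nn_integral_add nn_integral_cmult)
qed

end

theory Submission
  imports Defs
begin

text \<open>
  Fix a control and let \<open>m\<close> be the mixture of \<open>\<pi>\<close> and \<open>\<rho>\<close> with weight \<open>a\<close>. Given the next observation
  \<open>y\<close>, the posterior of \<open>m\<close> is the mixture of the posteriors of \<open>\<pi>\<close> and \<open>\<rho>\<close> whose weight is
  proportional to \<open>a\<close> times the density of \<open>y\<close> under \<open>\<pi>\<close>. Concavity of the next value function
  therefore gives an inequality at each \<open>y\<close>, in which the weights recombine to \<open>a\<close> and \<open>1 - a\<close> once it
  is multiplied by the density of \<open>y\<close> under \<open>m\<close>; the running cost is linear in the density.
  Integrating over \<open>y\<close> and taking the infimum over controls preserves concavity.

  Neither the cost nor the next value need be integrable separately, and for a given control only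
  the negative parts under \<open>\<pi>\<close> and \<open>\<rho>\<close> are known to have finite integral. So the inequality at each
  \<open>y\<close> is stated between nonnegative integrals, with negative parts moved to the opposite side.

  Well-posedness transfers from \<open>m\<close> to its posteriors only for almost every \<open>y\<close>, with an exceptional
  set depending on \<open>a\<close>. The induction is therefore on the inequality for a single triple
  \<open>\<pi>\<close>, \<open>\<rho>\<close>, \<open>m\<close>, not on concavity over a convex set of densities.
\<close>

section \<open>Integrals against a mixture\<close>

text \<open>If \<open>P\<close> is infinite then \<open>N\<close> is finite and the right side is
  \<infinity>. Otherwise the right side of \<open>le\<close> is finite, which forces
  \<open>N\<close>, \<open>Pp\<close> and \<open>Pr\<close> to be finite as well, and the claim is
  real arithmetic.\<close>

lemma ereal_mixture_le_diff:
  fixes P N Pp Np Pr Nr :: ennreal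
  assumes a: "0 < a" "a < 1"
    and fin: "Np < \<infinity>" "Nr < \<infinity>" "P < \<infinity> \<or> N < \<infinity>"
    and le: "N + (ennreal a * Pp + ennreal (1 - a) * Pr) \<le> P + (ennreal a * Np + ennreal (1 - a) * Nr)"
  shows "ereal a * (enn2ereal Pp - enn2ereal Np) + ereal (1 - a) * (enn2ereal Pr - enn2ereal Nr)
    \<le> enn2ereal P - enn2ereal N"
proof (cases "P = \<infinity>")
  case True
  with fin obtain n where "N = ennreal n" "0 \<le> n" by (cases N) auto
  with True show ?thesis by simp
next
  case False
  obtain np nr p where n: "Np = ennreal np" "0 \<le> np" "Nr = ennreal nr" "0 \<le> nr" "P = ennreal p" "0 \<le> p"
    using fin False by (metis ennreal_cases infinity_ennreal_def less_irrefl)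
  have "P + (ennreal a * Np + ennreal (1 - a) * Nr) < \<infinity>"
    using a n by (simp add: ennreal_mult_less_top)
  then have "N + (ennreal a * Pp + ennreal (1 - a) * Pr) < \<infinity>"
    using le by (rule le_less_trans[rotated])
  then have "N < \<infinity>" "Pp < \<infinity>" "Pr < \<infinity>"
    using a by (auto simp: ennreal_mult_less_top)
  then obtain m pp pr where m: "N = ennreal m" "0 \<le> m" "Pp = ennreal pp" "0 \<le> pp" "Pr = ennreal pr" "0 \<le> pr"
    by (metis ennreal_cases infinity_ennreal_def less_irrefl)
  have "m + (a * pp + (1 - a) * pr) \<le> p + (a * np + (1 - a) * nr)"
    using le a n m by (simp flip: ennreal_mult ennreal_plus)
  then show ?thesis
    using n m a by (simp add: algebra_simps)
qed

text \<open>Since \<open>ennreal\<close> truncates at 0, \<open>ennreal s\<close> and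
  \<open>ennreal (- s)\<close> are the positive and negative parts of a real \<open>s\<close>. Both
  claims integrate pointwise relations between the parts of \<open>c x + v\<close>,
  \<open>c x\<close> and \<open>v\<close>, written without subtraction because the integrals may be
  infinite.\<close>

lemma
  fixes v :: real
  assumes [measurable]: "p \<in> borel_measurable M" "c \<in> borel_measurable M"
  shows nn_integral_shift_eq:
      "(\<integral>\<^sup>+ x. p x * ennreal (c x + v) \<partial>M) + (\<integral>\<^sup>+ x. p x * ennreal (- c x) \<partial>M)
         + (\<integral>\<^sup>+ x. p x \<partial>M) * ennreal (- v)
       = (\<integral>\<^sup>+ x. p x * ennreal (- (c x + v)) \<partial>M) + (\<integral>\<^sup>+ x. p x * ennreal (c x) \<partial>M)
         + (\<integral>\<^sup>+ x. p x \<partial>M) * ennreal v" (is ?eq)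
    and nn_integral_unshift_le:
      "(\<integral>\<^sup>+ x. p x * ennreal (c x) \<partial>M)
       \<le> (\<integral>\<^sup>+ x. p x * ennreal (c x + v) \<partial>M) + (\<integral>\<^sup>+ x. p x \<partial>M) * ennreal (- v)" (is ?le)
proof -
  have 1: "ennreal (s + v) + ennreal (- s) + ennreal (- v)
      = ennreal (- (s + v)) + ennreal s + ennreal v" for s
    by (cases "0 \<le> s"; cases "0 \<le> v"; cases "0 \<le> s + v")
       (auto simp: ennreal_neg simp flip: ennreal_plus)
  have 2: "ennreal s \<le> ennreal (s + v) + ennreal (- v)" for s
    by (cases "0 \<le> v"; cases "0 \<le> s + v"; cases "0 \<le> s")
       (auto simp: ennreal_neg ennreal_leI simp flip: ennreal_plus)
  have "p x * ennreal (c x + v) + p x * ennreal (- c x) + p x * ennreal (- v)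
      = p x * ennreal (- (c x + v)) + p x * ennreal (c x) + p x * ennreal v" for x
    using 1[of "c x"] by (simp flip: distrib_left)
  then show ?eq
    by (simp flip: nn_integral_add nn_integral_multc)
  have "p x * ennreal (c x) \<le> p x * ennreal (c x + v) + p x * ennreal (- v)" for x
    using 2[of "c x"] by (simp add: mult_left_mono flip: distrib_left)
  then show ?le
    by (simp add: nn_integral_mono flip: nn_integral_add nn_integral_multc)
qed

section \<open>Shifted costs integrated against a mixture of two densities\<close>

lemma measurable_mixture[measurable]:
  assumes [measurable]: "f \<in> borel_measurable M" "g \<in> borel_measurable M"
  shows "mixture a f g \<in> borel_measurable M"
  unfolding mixture_def by measurable

lemma mixture_commute: "mixture a f g = mixture (1 - a) g f"
  by (simp add: mixture_def add.commute)

lemma nn_integral_mixture: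
  assumes [measurable]: "p \<in> borel_measurable M" "r \<in> borel_measurable M" "h \<in> borel_measurable M"
  shows "(\<integral>\<^sup>+ x. mixture a p r x * h x \<partial>M) =
    ennreal a * (\<integral>\<^sup>+ x. p x * h x \<partial>M) + ennreal (1 - a) * (\<integral>\<^sup>+ x. r x * h x \<partial>M)"
  by (simp add: mixture_def distrib_right mult.assoc nn_integral_add nn_integral_cmult)

text \<open>The densities \<open>p\<close> and \<open>r\<close> are unnormalised, with masses
  \<open>dp\<close> and \<open>dr\<close>. An infinite \<open>?Pm\<close> makes the claim trivial. A
  finite one bounds the positive part of \<open>c\<close> under both densities, while
  \<open>N\<close> bounds its negative part; then all integrals are finite, the contributions of
  \<open>c\<close> cancel by linearity, and \<open>v\<close> is what remains.\<close>

lemma mixture_shift_real: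
  fixes vp vr vm :: real
  assumes [measurable]: "p \<in> borel_measurable M" "r \<in> borel_measurable M" "c \<in> borel_measurable M"
    and a: "0 < a" "a < 1"
    and d: "(\<integral>\<^sup>+ x. p x \<partial>M) = ennreal dp" "0 \<le> dp" "(\<integral>\<^sup>+ x. r x \<partial>M) = ennreal dr" "0 \<le> dr"
    and v: "a * dp * vp + (1 - a) * dr * vr \<le> (a * dp + (1 - a) * dr) * vm"
    and N: "(\<integral>\<^sup>+ x. p x * ennreal (- (c x + vp)) \<partial>M) < \<infinity>"
      "(\<integral>\<^sup>+ x. r x * ennreal (- (c x + vr)) \<partial>M) < \<infinity>"
  shows "(\<integral>\<^sup>+ x. mixture a p r x * ennreal (- (c x + vm)) \<partial>M)
      + (ennreal a * (\<integral>\<^sup>+ x. p x * ennreal (c x + vp) \<partial>M)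
        + ennreal (1 - a) * (\<integral>\<^sup>+ x. r x * ennreal (c x + vr) \<partial>M))
    \<le> (\<integral>\<^sup>+ x. mixture a p r x * ennreal (c x + vm) \<partial>M)
      + (ennreal a * (\<integral>\<^sup>+ x. p x * ennreal (- (c x + vp)) \<partial>M)
        + ennreal (1 - a) * (\<integral>\<^sup>+ x. r x * ennreal (- (c x + vr)) \<partial>M))"
    (is "?Nm + (_ * ?Pp + _ * ?Pr) \<le> ?Pm + (_ * ?Np + _ * ?Nr)")
proof (cases "?Pm = \<infinity>")
  case True
  then show ?thesis by simp
next
  case False
  let ?q = "mixture a p r"
  have q[measurable]: "?q \<in> borel_measurable M" by simp
  let ?dm = "a * dp + (1 - a) * dr"
  have dm: "(\<integral>\<^sup>+ x. ?q x \<partial>M) = ennreal ?dm"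
    using nn_integral_mixture[of p M r "\<lambda>_. 1" a] d a
    by (simp flip: ennreal_mult ennreal_plus)
  have dm0: "0 \<le> ?dm" using a d by simp
  let ?J = "\<lambda>f h. \<integral>\<^sup>+ x. f x * ennreal (h x) \<partial>M"
  have neg: "?J f (\<lambda>x. - c x) \<le> ?J f (\<lambda>x. - (c x + w)) + (\<integral>\<^sup>+ x. f x \<partial>M) * ennreal w"
    if [measurable]: "f \<in> borel_measurable M" for f w
    using nn_integral_unshift_le[of f M "\<lambda>x. - c x" "- w"] by simp
  have fin: "?J p (\<lambda>x. - c x) < \<infinity>" "?J r (\<lambda>x. - c x) < \<infinity>"
    using neg[of p vp] neg[of r vr] N d
    by (auto simp: ennreal_mult_less_top intro: le_less_trans)
  have "?J ?q c < \<infinity>"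
    using nn_integral_unshift_le[of ?q M c vm] False dm
    by (auto simp: ennreal_mult_less_top top.not_eq_extremum intro: le_less_trans)
  then have cfin: "?J p c < \<infinity>" "?J r c < \<infinity>"
    using a by (auto simp: nn_integral_mixture ennreal_mult_less_top)
  have pos: "?J f (\<lambda>x. c x + w) \<le> ?J f c + (\<integral>\<^sup>+ x. f x \<partial>M) * ennreal w"
    if [measurable]: "f \<in> borel_measurable M" for f w
    using nn_integral_unshift_le[of f M "\<lambda>x. c x + w" "- w"] by simp
  have Pfin: "?Pp < \<infinity>" "?Pr < \<infinity>"
    using pos[of p vp] pos[of r vr] cfin d
    by (auto simp: ennreal_mult_less_top intro: le_less_trans)
  have "?J ?q (\<lambda>x. - c x) < \<infinity>"
    using fin by (simp add: nn_integral_mixture ennreal_mult_less_top)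
  then have Nfin: "?Nm < \<infinity>"
    using nn_integral_unshift_le[of ?q M "\<lambda>x. - (c x + vm)" "vm"] dm
    by (auto simp: ennreal_mult_less_top intro: le_less_trans)
  obtain cp cr cp' cr' where
    c: "?J p c = ennreal cp" "?J r c = ennreal cr" "0 \<le> cp" "0 \<le> cr"
       "?J p (\<lambda>x. - c x) = ennreal cp'" "?J r (\<lambda>x. - c x) = ennreal cr'" "0 \<le> cp'" "0 \<le> cr'"
    using fin cfin unfolding infinity_ennreal_def less_top_ennreal by blast
  obtain Pp Pr Pm Np Nr Nm where
    P: "?Pp = ennreal Pp" "?Pr = ennreal Pr" "?Pm = ennreal Pm" "0 \<le> Pp" "0 \<le> Pr" "0 \<le> Pm" and
    N': "?Np = ennreal Np" "?Nr = ennreal Nr" "?Nm = ennreal Nm" "0 \<le> Np" "0 \<le> Nr" "0 \<le> Nm"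
    using Pfin Nfin N False unfolding infinity_ennreal_def top.not_eq_extremum less_top_ennreal by blast
  have cm: "?J ?q c = ennreal (a * cp + (1 - a) * cr)"
     "?J ?q (\<lambda>x. - c x) = ennreal (a * cp' + (1 - a) * cr')"
    using a c by (simp_all add: nn_integral_mixture flip: ennreal_mult ennreal_plus)
  \<comment> \<open>The shift identity between finite quantities: shifting by \<open>w\<close>
    changes the integral by mass times \<open>w\<close>. At most one of \<open>ennreal w\<close> and
    \<open>ennreal (- w)\<close> is nonzero, hence the two cases.\<close>
  have shift: "P + C' - (N + C) = D * w"
    if "ennreal P + ennreal C' + ennreal D * ennreal (- w) = ennreal N + ennreal C + ennreal D * ennreal w"
      "0 \<le> P" "0 \<le> C'" "0 \<le> N" "0 \<le> C" "0 \<le> D" for P C' N C D w :: real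
  proof (cases "0 \<le> w")
    case True
    with that have "P + C' = N + C + D * w"
      by (simp add: ennreal_neg flip: ennreal_mult ennreal_plus)
    then show ?thesis by simp
  next
    case False
    define e where "e = D * (- w)"
    have e: "ennreal D * ennreal (- w) = ennreal e" "0 \<le> e"
      using False that(6) by (simp_all add: e_def mult_le_0_iff del: mult_minus_right flip: ennreal_mult)
    have "P + C' + e = N + C"
      using False that unfolding e(1) by (simp add: ennreal_neg e(2) flip: ennreal_plus)
    then show ?thesis by (simp add: e_def)
  qed
  have "Pp + cp' - (Np + cp) = dp * vp"
    using nn_integral_shift_eq[of p M c vp] c P N' d by (intro shift) auto
  moreover have "Pr + cr' - (Nr + cr) = dr * vr"
    using nn_integral_shift_eq[of r M c vr] c P N' d by (intro shift) auto
  moreover have "Pm + (a * cp' + (1 - a) * cr') - (Nm + (a * cp + (1 - a) * cr)) = ?dm * vm"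
    using nn_integral_shift_eq[of ?q M c vm] cm c P N' dm dm0 a by (intro shift) auto
  ultimately have "Nm + (a * Pp + (1 - a) * Pr) \<le> Pm + (a * Np + (1 - a) * Nr)"
  proof -
    assume h: "Pp + cp' - (Np + cp) = dp * vp" "Pr + cr' - (Nr + cr) = dr * vr"
      "Pm + (a * cp' + (1 - a) * cr') - (Nm + (a * cp + (1 - a) * cr)) = ?dm * vm"
    have "a * (Pp + cp' - (Np + cp)) + (1 - a) * (Pr + cr' - (Nr + cr)) = a * dp * vp + (1 - a) * dr * vr"
      unfolding h by (simp add: algebra_simps)
    with h(3) v show ?thesis by (simp add: algebra_simps)
  qed
  then show ?thesis
    using P N' a by (simp flip: ennreal_mult ennreal_plus)
qed

text \<open>This is the comparison at one observation: \<open>p\<close> and \<open>r\<close> become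
  joint densities there, and \<open>vp\<close>, \<open>vr\<close>, \<open>vm\<close> the next values
  at the posteriors. A density of mass zero drops out of every integral, leaving an equality; if
  both masses are positive, either the right side is infinite or all values are real.\<close>

lemma mixture_shift:
  fixes vp vr vm :: ereal
  assumes [measurable]: "p \<in> borel_measurable M" "r \<in> borel_measurable M" "c \<in> borel_measurable M"
    and a: "0 < a" "a < 1"
    and d: "(\<integral>\<^sup>+ x. p x \<partial>M) = ennreal dp" "0 \<le> dp" "(\<integral>\<^sup>+ x. r x \<partial>M) = ennreal dr" "0 \<le> dr"
    and v: "0 < dp \<Longrightarrow> 0 < dr \<Longrightarrow> vp \<noteq> -\<infinity> \<Longrightarrow> vr \<noteq> -\<infinity> \<Longrightarrow>
        ereal (a * dp / (a * dp + (1 - a) * dr)) * vp +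
        ereal (1 - a * dp / (a * dp + (1 - a) * dr)) * vr \<le> vm"
      "0 < dp \<Longrightarrow> dr = 0 \<Longrightarrow> vm = vp" "dp = 0 \<Longrightarrow> 0 < dr \<Longrightarrow> vm = vr"
    and N: "(\<integral>\<^sup>+ x. p x * e2ennreal (- (ereal (c x) + vp)) \<partial>M) < \<infinity>"
      "(\<integral>\<^sup>+ x. r x * e2ennreal (- (ereal (c x) + vr)) \<partial>M) < \<infinity>"
  shows "(\<integral>\<^sup>+ x. mixture a p r x * e2ennreal (- (ereal (c x) + vm)) \<partial>M)
      + (ennreal a * (\<integral>\<^sup>+ x. p x * e2ennreal (ereal (c x) + vp) \<partial>M)
        + ennreal (1 - a) * (\<integral>\<^sup>+ x. r x * e2ennreal (ereal (c x) + vr) \<partial>M))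
    \<le> (\<integral>\<^sup>+ x. mixture a p r x * e2ennreal (ereal (c x) + vm) \<partial>M)
      + (ennreal a * (\<integral>\<^sup>+ x. p x * e2ennreal (- (ereal (c x) + vp)) \<partial>M)
        + ennreal (1 - a) * (\<integral>\<^sup>+ x. r x * e2ennreal (- (ereal (c x) + vr)) \<partial>M))"
proof -
  have null: "(\<integral>\<^sup>+ x. f x * h x \<partial>M) = 0"
    if "f \<in> borel_measurable M" "(\<integral>\<^sup>+ x. f x \<partial>M) = ennreal 0" for f and h :: "_ \<Rightarrow> ennreal"
  proof -
    have "AE x in M. f x = 0" using that by (simp add: nn_integral_0_iff_AE)
    then have "(\<integral>\<^sup>+ x. f x * h x \<partial>M) = (\<integral>\<^sup>+ x. 0 \<partial>M)"
      by (intro nn_integral_cong_AE) auto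
    then show ?thesis by simp
  qed
  have meas[measurable]: "(\<lambda>x. e2ennreal (ereal (c x) + w)) \<in> borel_measurable M"
    "(\<lambda>x. e2ennreal (- (ereal (c x) + w))) \<in> borel_measurable M" for w
    by measurable
  note mix = nn_integral_mixture[OF assms(1,2) meas(1)] nn_integral_mixture[OF assms(1,2) meas(2)]
  consider "dp = 0" "dr = 0" | "0 < dp" "dr = 0" | "dp = 0" "0 < dr" | "0 < dp" "0 < dr"
    using d by linarith
  then show ?thesis
  proof cases
    case 1
    then show ?thesis using d by (simp add: mix null)
  next
    case 2
    then show ?thesis unfolding mix using d v(2) by (simp add: null add.commute)
  next
    case 3
    then show ?thesis unfolding mix using d v(3) by (simp add: null add.commute)
  next
    case 4
    have dpr: "(\<integral>\<^sup>+ x. p x * \<infinity> \<partial>M) = \<infinity>" "(\<integral>\<^sup>+ x. r x * \<infinity> \<partial>M) = \<infinity>"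
      unfolding nn_integral_multc[OF assms(1)] nn_integral_multc[OF assms(2)] d
      using 4 by (simp_all add: ennreal_mult_top)
    \<comment> \<open>With value \<open>-\<infinity>\<close> the integrand in \<open>N\<close> would
      be the density times \<infinity>, whose integral is infinite because the mass is
      positive.\<close>
    have fin: "vp \<noteq> -\<infinity>" "vr \<noteq> -\<infinity>"
      using N dpr by auto
    define l where "l = a * dp / (a * dp + (1 - a) * dr)"
    have dm: "0 < a * dp + (1 - a) * dr" using 4 a by (simp add: add_pos_pos)
    then have l: "0 < l" "l < 1" using 4 a by (auto simp: l_def divide_simps)
    note le = v(1)[OF 4 fin, folded l_def]
    show ?thesis
    proof (cases "vm = \<infinity>")
      case True
      have "(\<integral>\<^sup>+ x. mixture a p r x * \<infinity> \<partial>M) = \<infinity>"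
        unfolding nn_integral_mixture[OF assms(1,2) borel_measurable_const] dpr
        using a by (simp add: ennreal_mult_top)
      with True show ?thesis by (simp)
    next
      case False
      \<comment> \<open>If \<open>vp\<close> or \<open>vr\<close> were \<infinity>,
        \<open>le\<close> would force \<open>vm\<close> to be \<infinity>.\<close>
      with le fin l obtain wp wr wm where w: "vp = ereal wp" "vr = ereal wr" "vm = ereal wm"
        by (cases vp; cases vr; cases vm) auto
      have "l * wp + (1 - l) * wr \<le> wm" using le w by simp
      \<comment> \<open>Multiplying by the mass of the mixture turns the posterior weights
        \<open>l\<close> and \<open>1 - l\<close> back into \<open>a * dp\<close> and
        \<open>(1 - a) * dr\<close>.\<close>
      then have "(a * dp + (1 - a) * dr) * (l * wp + (1 - l) * wr) \<le> (a * dp + (1 - a) * dr) * wm"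
        using dm by (intro mult_left_mono) auto
      also have "(a * dp + (1 - a) * dr) * (l * wp + (1 - l) * wr) = a * dp * wp + (1 - a) * dr * wr"
      proof -
        have ml: "(a * dp + (1 - a) * dr) * l = a * dp"
          using dm by (simp add: l_def)
        have "(a * dp + (1 - a) * dr) * (l * wp + (1 - l) * wr)
            = ((a * dp + (1 - a) * dr) * l) * wp
              + (a * dp + (1 - a) * dr - (a * dp + (1 - a) * dr) * l) * wr"
          by (simp only: algebra_simps)
        then show ?thesis unfolding ml by simp
      qed
      finally have "a * dp * wp + (1 - a) * dr * wr \<le> (a * dp + (1 - a) * dr) * wm" .
      from mixture_shift_real[OF assms(1-5) d this] N show ?thesis
        unfolding w by (simp)
    qed
  qed
qed

section \<open>Disintegration over the observation\<close>

text \<open>One stage under a fixed control: \<open>A\<close> and \<open>B\<close> carry the current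
  and next pairs of states, \<open>Y\<close> the observations; \<open>K\<close> and \<open>L\<close>
  are the transition and observation densities, and \<open>c\<close> is the stage cost.\<close>

locale bayes_step =
  A: sigma_finite_measure A + B: sigma_finite_measure B + Y: sigma_finite_measure Y
  for A :: "'a measure" and B :: "'b measure" and Y :: "'y measure" +
  fixes K :: "'a \<Rightarrow> 'b \<Rightarrow> ennreal" and L :: "'b \<Rightarrow> 'y \<Rightarrow> ennreal" and c :: "'a \<Rightarrow> 'b \<Rightarrow> real"
  assumes K_measurable: "(\<lambda>(z, z'). K z z') \<in> borel_measurable (A \<Otimes>\<^sub>M B)"
    and L_measurable: "(\<lambda>(z', y). L z' y) \<in> borel_measurable (B \<Otimes>\<^sub>M Y)"
    and c_measurable: "(\<lambda>(z, z'). c z z') \<in> borel_measurable (A \<Otimes>\<^sub>M B)"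
    and K_prob: "z \<in> space A \<Longrightarrow> (\<integral>\<^sup>+ z'. K z z' \<partial>B) = 1"
    and L_prob: "z' \<in> space B \<Longrightarrow> (\<integral>\<^sup>+ y. L z' y \<partial>Y) = 1"
begin

sublocale AB: pair_sigma_finite A B ..
sublocale BY: pair_sigma_finite B Y ..

sublocale AB_Y: pair_sigma_finite "A \<Otimes>\<^sub>M B" Y ..

lemma measurable_compose_K[measurable (raw)]:
  "f \<in> measurable N A \<Longrightarrow> g \<in> measurable N B \<Longrightarrow> (\<lambda>w. K (f w) (g w)) \<in> borel_measurable N"
  using measurable_compose[OF measurable_Pair K_measurable] by simp

lemma measurable_compose_L[measurable (raw)]:
  "f \<in> measurable N B \<Longrightarrow> g \<in> measurable N Y \<Longrightarrow> (\<lambda>w. L (f w) (g w)) \<in> borel_measurable N"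
  using measurable_compose[OF measurable_Pair L_measurable] by simp

lemma measurable_compose_c[measurable (raw)]:
  "f \<in> measurable N A \<Longrightarrow> g \<in> measurable N B \<Longrightarrow> (\<lambda>w. c (f w) (g w)) \<in> borel_measurable N"
  using measurable_compose[OF measurable_Pair c_measurable] by simp

section \<open>The densities of one Bayes step and their disintegration\<close>

definition joint :: "('a \<Rightarrow> ennreal) \<Rightarrow> 'y \<Rightarrow> 'a \<times> 'b \<Rightarrow> ennreal" where
  "joint \<pi> y = (\<lambda>(z, z'). L z' y * K z z' * \<pi> z)"

definition predict :: "('a \<Rightarrow> ennreal) \<Rightarrow> 'b \<Rightarrow> ennreal" where
  "predict \<pi> z' = (\<integral>\<^sup>+ z. K z z' * \<pi> z \<partial>A)"

definition marginal :: "('a \<Rightarrow> ennreal) \<Rightarrow> 'y \<Rightarrow> ennreal" where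
  "marginal \<pi> y = (\<integral>\<^sup>+ z'. L z' y * predict \<pi> z' \<partial>B)"

definition posterior :: "('a \<Rightarrow> ennreal) \<Rightarrow> 'y \<Rightarrow> 'b \<Rightarrow> ennreal" where
  "posterior \<pi> y z' = L z' y * predict \<pi> z' / marginal \<pi> y"

definition law :: "('a \<Rightarrow> ennreal) \<Rightarrow> ('a \<times> 'b \<times> 'y) measure" where
  "law \<pi> = density (A \<Otimes>\<^sub>M B \<Otimes>\<^sub>M Y) (\<lambda>(z, z', y). joint \<pi> y (z, z'))"

lemma measurable_predict[measurable]:
  assumes [measurable]: "\<pi> \<in> borel_measurable A"
  shows "predict \<pi> \<in> borel_measurable B"
  unfolding predict_def by measurable

lemma measurable_marginal[measurable]:
  assumes [measurable]: "\<pi> \<in> borel_measurable A"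
  shows "marginal \<pi> \<in> borel_measurable Y"
  unfolding marginal_def by measurable

lemma measurable_posterior:
  assumes [measurable]: "\<pi> \<in> borel_measurable A" "y \<in> space Y"
  shows "posterior \<pi> y \<in> borel_measurable B"
  unfolding posterior_def by measurable

lemma measurable_joint[measurable]:
  assumes [measurable]: "\<pi> \<in> borel_measurable A"
  shows "y \<in> space Y \<Longrightarrow> joint \<pi> y \<in> borel_measurable (A \<Otimes>\<^sub>M B)"
    and "(\<lambda>(z, z', y). joint \<pi> y (z, z')) \<in> borel_measurable (A \<Otimes>\<^sub>M B \<Otimes>\<^sub>M Y)"
    and "(\<lambda>(y, x). joint \<pi> y x) \<in> borel_measurable (Y \<Otimes>\<^sub>M (A \<Otimes>\<^sub>M B))"
  unfolding joint_def by measurable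

text \<open>Tonelli's theorem, bringing the observation from the innermost to the outermost integral
  so that the comparison can be made at each observation.\<close>

lemma nn_integral_disintegrate:
  assumes f[measurable]: "f \<in> borel_measurable (A \<Otimes>\<^sub>M B \<Otimes>\<^sub>M Y)"
  shows "(\<integral>\<^sup>+ w. f w \<partial>(A \<Otimes>\<^sub>M B \<Otimes>\<^sub>M Y)) = (\<integral>\<^sup>+ y. (\<integral>\<^sup>+ (z, z'). f (z, z', y) \<partial>(A \<Otimes>\<^sub>M B)) \<partial>Y)"
proof -
  have "(\<integral>\<^sup>+ w. f w \<partial>(A \<Otimes>\<^sub>M B \<Otimes>\<^sub>M Y)) = (\<integral>\<^sup>+ z. (\<integral>\<^sup>+ w. f (z, w) \<partial>(B \<Otimes>\<^sub>M Y)) \<partial>A)"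
    by (rule BY.P.nn_integral_fst[symmetric]) simp
  also have "\<dots> = (\<integral>\<^sup>+ z. (\<integral>\<^sup>+ z'. (\<integral>\<^sup>+ y. f (z, z', y) \<partial>Y) \<partial>B) \<partial>A)"
    by (intro nn_integral_cong) (simp flip: Y.nn_integral_fst)
  also have "\<dots> = (\<integral>\<^sup>+ x. (\<integral>\<^sup>+ y. f (fst x, snd x, y) \<partial>Y) \<partial>(A \<Otimes>\<^sub>M B))"
    by (simp flip: B.nn_integral_fst)
  also have "\<dots> = (\<integral>\<^sup>+ y. (\<integral>\<^sup>+ x. f (fst x, snd x, y) \<partial>(A \<Otimes>\<^sub>M B)) \<partial>Y)"
    by (rule AB_Y.Fubini'[symmetric]) simp
  finally show ?thesis by (simp add: case_prod_beta')
qed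

text \<open>\<open>Q\<close> need not be measurable, so its exceptional set is first enclosed in a
  measurable null set; by Tonelli almost every section of that set is null.\<close>

lemma AE_disintegrate:
  assumes "AE w in A \<Otimes>\<^sub>M B \<Otimes>\<^sub>M Y. Q w"
  shows "AE y in Y. AE x in A \<Otimes>\<^sub>M B. Q (fst x, snd x, y)"
proof -
  obtain N where N: "{w \<in> space (A \<Otimes>\<^sub>M B \<Otimes>\<^sub>M Y). \<not> Q w} \<subseteq> N" "emeasure (A \<Otimes>\<^sub>M B \<Otimes>\<^sub>M Y) N = 0"
    and [measurable]: "N \<in> sets (A \<Otimes>\<^sub>M B \<Otimes>\<^sub>M Y)"
    using assms by (rule AE_E)
  have "(\<integral>\<^sup>+ y. (\<integral>\<^sup>+ (z, z'). indicator N (z, z', y) \<partial>(A \<Otimes>\<^sub>M B)) \<partial>Y) = 0"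
    using N(2) by (simp flip: nn_integral_disintegrate)
  then have "AE y in Y. (\<integral>\<^sup>+ (z, z'). (indicator N (z, z', y) :: ennreal) \<partial>(A \<Otimes>\<^sub>M B)) = 0"
    by (subst (asm) nn_integral_0_iff_AE) auto
  moreover have "AE y in Y. y \<in> space Y" by simp
  ultimately show ?thesis
  proof eventually_elim
    case (elim y)
    then have [measurable]: "y \<in> space Y" by simp
    have "AE x in A \<Otimes>\<^sub>M B. (case x of (z, z') \<Rightarrow> indicator N (z, z', y)) = (0 :: ennreal)"
      using elim(1) by (subst (asm) nn_integral_0_iff_AE) auto
    moreover have "AE x in A \<Otimes>\<^sub>M B. x \<in> space (A \<Otimes>\<^sub>M B)" by simp
    ultimately show ?case
    proof eventually_elim
      case (elim x)
      then have "(fst x, snd x, y) \<notin> N" "(fst x, snd x, y) \<in> space (A \<Otimes>\<^sub>M B \<Otimes>\<^sub>M Y)"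
        using \<open>y \<in> space Y\<close> by (auto simp: case_prod_beta' space_pair_measure indicator_def split: if_splits)
      then show ?case using N(1) by auto
    qed
  qed
qed

lemma nn_integral_joint:
  assumes [measurable]: "\<pi> \<in> borel_measurable A" and y[measurable]: "y \<in> space Y"
  shows "(\<integral>\<^sup>+ x. joint \<pi> y x \<partial>(A \<Otimes>\<^sub>M B)) = marginal \<pi> y"
proof -
  have "(\<integral>\<^sup>+ x. joint \<pi> y x \<partial>(A \<Otimes>\<^sub>M B)) = (\<integral>\<^sup>+ z'. (\<integral>\<^sup>+ z. joint \<pi> y (z, z') \<partial>A) \<partial>B)"
    by (rule AB.nn_integral_snd[symmetric, of "joint \<pi> y"]) simp
  also have "\<dots> = marginal \<pi> y"
    unfolding marginal_def predict_def joint_def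
    by (intro nn_integral_cong) (simp add: mult.assoc nn_integral_cmult)
  finally show ?thesis .
qed

text \<open>Both kernels have total mass one, so mass is preserved. For a probability density this
  makes the marginal finite at almost every observation.\<close>

lemma nn_integral_marginal:
  assumes [measurable]: "\<pi> \<in> borel_measurable A"
  shows "(\<integral>\<^sup>+ y. marginal \<pi> y \<partial>Y) = (\<integral>\<^sup>+ z. \<pi> z \<partial>A)"
proof -
  have "(\<integral>\<^sup>+ y. marginal \<pi> y \<partial>Y) = (\<integral>\<^sup>+ z'. (\<integral>\<^sup>+ y. L z' y * predict \<pi> z' \<partial>Y) \<partial>B)"
    unfolding marginal_def by (rule BY.Fubini') simp
  also have "\<dots> = (\<integral>\<^sup>+ z'. predict \<pi> z' \<partial>B)"
    by (intro nn_integral_cong) (simp add: nn_integral_multc L_prob)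
  also have "\<dots> = (\<integral>\<^sup>+ z. (\<integral>\<^sup>+ z'. K z z' * \<pi> z \<partial>B) \<partial>A)"
    unfolding predict_def by (rule AB.Fubini') simp
  also have "\<dots> = (\<integral>\<^sup>+ z. \<pi> z \<partial>A)"
    by (intro nn_integral_cong) (simp add: nn_integral_multc K_prob)
  finally show ?thesis .
qed

lemma nn_integral_posterior:
  assumes [measurable]: "\<pi> \<in> borel_measurable A" and y[measurable]: "y \<in> space Y"
    and "0 < marginal \<pi> y" "marginal \<pi> y < \<infinity>"
  shows "(\<integral>\<^sup>+ z'. posterior \<pi> y z' \<partial>B) = 1"
proof -
  have "(\<integral>\<^sup>+ z'. posterior \<pi> y z' \<partial>B) = marginal \<pi> y / marginal \<pi> y"
    unfolding posterior_def by (subst nn_integral_divide) (simp_all flip: marginal_def)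
  then show ?thesis using assms(3,4) by simp
qed

section \<open>Prediction, marginal and posterior of a mixture\<close>

lemma predict_mixture:
  assumes [measurable]: "\<pi> \<in> borel_measurable A" "\<rho> \<in> borel_measurable A" "z' \<in> space B"
  shows "predict (mixture a \<pi> \<rho>) z' = mixture a (predict \<pi>) (predict \<rho>) z'"
  using nn_integral_mixture[of \<pi> A \<rho> "\<lambda>z. K z z'" a]
  by (simp add: predict_def mixture_def mult.commute)

lemma marginal_mixture:
  assumes [measurable]: "\<pi> \<in> borel_measurable A" "\<rho> \<in> borel_measurable A" "y \<in> space Y"
  shows "marginal (mixture a \<pi> \<rho>) y = mixture a (marginal \<pi>) (marginal \<rho>) y"
proof -
  have "marginal (mixture a \<pi> \<rho>) y = (\<integral>\<^sup>+ z'. mixture a (predict \<pi>) (predict \<rho>) z' * L z' y \<partial>B)"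
    unfolding marginal_def by (intro nn_integral_cong) (simp add: predict_mixture mult.commute)
  also have "\<dots> = mixture a (marginal \<pi>) (marginal \<rho>) y"
    by (subst nn_integral_mixture) (simp_all add: mixture_def marginal_def mult.commute)
  finally show ?thesis .
qed

lemma joint_mixture: "joint (mixture a \<pi> \<rho>) y = mixture a (joint \<pi> y) (joint \<rho> y)"
  by (auto simp: joint_def mixture_def distrib_left ac_simps)

text \<open>Prediction and marginal are linear in the density, so only the normalisation depends
  nonlinearly on it; it replaces the weight \<open>a\<close> by the conditional weight given
  \<open>y\<close>.\<close>

lemma posterior_mixture:
  assumes [measurable]: "\<pi> \<in> borel_measurable A" "\<rho> \<in> borel_measurable A" "y \<in> space Y" "z' \<in> space B"
    and a: "0 < a" "a < 1"
    and d: "marginal \<pi> y = ennreal d" "0 < d" "marginal \<rho> y = ennreal e" "0 < e"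
  shows "posterior (mixture a \<pi> \<rho>) y z' =
    mixture (a * d / (a * d + (1 - a) * e)) (posterior \<pi> y) (posterior \<rho> y) z'"
proof -
  let ?m = "a * d + (1 - a) * e"
  have m: "0 < ?m" using a d by (simp add: add_pos_pos)
  have marg: "marginal (mixture a \<pi> \<rho>) y = ennreal ?m"
    using a d by (subst marginal_mixture[OF assms(1-3)]) (simp add: mixture_def flip: ennreal_mult ennreal_plus)
  have coeff: "ennreal b * x / ennreal ?m = ennreal (b * f / ?m) * (x / ennreal f)"
    if "0 < f" "0 < b" for b f x
  proof -
    have "ennreal (b * f / ?m) = ennreal b * ennreal f * inverse (ennreal ?m)"
      using that m by (simp add: inverse_ennreal divide_inverse flip: ennreal_mult)
    moreover have "ennreal f * inverse (ennreal f) = 1"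
      using that by (simp add: inverse_ennreal flip: ennreal_mult)
    \<comment> \<open>The factor \<open>ennreal f * inverse (ennreal f)\<close>, equal to 1 since
      \<open>f\<close> is positive and finite, is inserted to produce the normalised
      density.\<close>
    ultimately have "ennreal b * x / ennreal ?m
        = (ennreal b * x * inverse (ennreal ?m)) * (ennreal f * inverse (ennreal f))"
      "ennreal (b * f / ?m) * (x / ennreal f)
        = ennreal b * ennreal f * inverse (ennreal ?m) * (x * inverse (ennreal f))"
      by (simp_all only: divide_ennreal_def mult_1_right)
    then show ?thesis by (simp only: ac_simps)
  qed
  have eq: "1 - a * d / ?m = (1 - a) * e / ?m" using m by (simp add: field_simps)
  have "posterior (mixture a \<pi> \<rho>) y z'
      = L z' y * mixture a (predict \<pi>) (predict \<rho>) z' / ennreal ?m"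
    unfolding posterior_def marg predict_mixture[OF assms(1,2,4)] ..
  also have "\<dots> = ennreal a * (L z' y * predict \<pi> z') / ennreal ?m
      + ennreal (1 - a) * (L z' y * predict \<rho> z') / ennreal ?m"
    unfolding mixture_def distrib_left add_divide_distrib_ennreal by (simp only: mult.left_commute)
  also have "\<dots> = mixture (a * d / ?m) (posterior \<pi> y) (posterior \<rho> y) z'"
    unfolding mixture_def posterior_def d eq using a d by (subst (1 2) coeff) auto
  finally show ?thesis .
qed

text \<open>The part of the numerator coming from \<open>\<rho>\<close> integrates to zero, so it
  vanishes almost everywhere, and \<open>a\<close> cancels. Only almost everywhere equality results,
  so the value function has to respect null sets.\<close>

lemma posterior_mixture_null:
  assumes [measurable]: "\<pi> \<in> borel_measurable A" "\<rho> \<in> borel_measurable A" "y \<in> space Y"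
    and a: "0 < a" "a < 1"
    and d: "marginal \<pi> y = ennreal d" "0 < d" "marginal \<rho> y = 0"
  shows "AE z' in B. posterior (mixture a \<pi> \<rho>) y z' = posterior \<pi> y z'"
proof -
  have "AE z' in B. L z' y * predict \<rho> z' = 0"
    using d(3) unfolding marginal_def by (subst (asm) nn_integral_0_iff_AE) auto
  moreover have "AE z' in B. z' \<in> space B" by simp
  ultimately show ?thesis
  proof eventually_elim
    case (elim z')
    have "ennreal a * x / (ennreal a * ennreal d) = x / ennreal d" for x
      using a d by (simp add: divide_ennreal_def ennreal_inverse_mult mult.assoc mult.left_commute)
        (simp add: inverse_ennreal flip: ennreal_mult mult.assoc)
    with elim d show ?case
      by (simp add: posterior_def predict_mixture marginal_mixture[OF assms(1-3)])
        (auto simp: mixture_def distrib_left mult.left_commute)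
  qed
qed

section \<open>Invariance under changes of the density on null sets\<close>

lemma law_cong_AE:
  assumes [measurable]: "\<pi> \<in> borel_measurable A" "\<rho> \<in> borel_measurable A"
    and ae: "AE z in A. \<pi> z = \<rho> z"
  shows "law \<pi> = law \<rho>"
proof -
  interpret A_BY: pair_sigma_finite A "B \<Otimes>\<^sub>M Y" ..
  have "AE w in A \<Otimes>\<^sub>M B \<Otimes>\<^sub>M Y. \<pi> (fst w) = \<rho> (fst w)"
    using ae by (intro A_BY.AE_pair_measure) auto
  then show ?thesis
    unfolding law_def by (intro density_cong) (auto simp: joint_def)
qed

text \<open>The density enters only through the integral in \<open>predict\<close>, so the
  posteriors agree everywhere and not merely almost everywhere.\<close>

lemma posterior_cong_AE:
  assumes "AE z in A. \<pi> z = \<rho> z"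
  shows "posterior \<pi> = posterior \<rho>"
proof -
  have "predict \<pi> z' = predict \<rho> z'" for z'
    unfolding predict_def using assms by (intro nn_integral_cong_AE) auto
  then show ?thesis by (simp add: fun_eq_iff posterior_def marginal_def)
qed

section \<open>Integrals and almost sure statements under the law of one stage\<close>

lemma sets_law[measurable_cong, simp]: "sets (law \<pi>) = sets (A \<Otimes>\<^sub>M B \<Otimes>\<^sub>M Y)"
  by (simp add: law_def)

lemma AE_law:
  assumes [measurable]: "\<pi> \<in> borel_measurable A"
  shows "(AE w in law \<pi>. Q w) \<longleftrightarrow>
    (AE w in A \<Otimes>\<^sub>M B \<Otimes>\<^sub>M Y. 0 < joint \<pi> (snd (snd w)) (fst w, fst (snd w)) \<longrightarrow> Q w)"
  unfolding law_def by (subst AE_density) (simp_all add: case_prod_beta')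

text \<open>If \<open>W y\<close> fails outside the exceptional null set, the joint density at
  \<open>y\<close> vanishes almost everywhere and the marginal is 0. This transfers well-posedness
  of posteriors to almost every observation of positive marginal.\<close>

lemma AE_law_obs:
  assumes [measurable]: "\<pi> \<in> borel_measurable A" and W: "AE (z, z', y) in law \<pi>. W y"
  shows "AE y in Y. 0 < marginal \<pi> y \<longrightarrow> W y"
proof -
  have "AE w in A \<Otimes>\<^sub>M B \<Otimes>\<^sub>M Y. 0 < joint \<pi> (snd (snd w)) (fst w, fst (snd w)) \<longrightarrow> W (snd (snd w))"
    using W by (simp add: AE_law case_prod_beta')
  from AE_disintegrate[OF this]
  have "AE y in Y. AE x in A \<Otimes>\<^sub>M B. 0 < joint \<pi> y x \<longrightarrow> W y"
    by simp
  moreover have "AE y in Y. y \<in> space Y" by simp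
  ultimately show ?thesis
  proof eventually_elim
    case (elim y)
    then have y[measurable]: "y \<in> space Y" by simp
    show ?case
    proof (rule impI, rule ccontr)
      assume "0 < marginal \<pi> y" "\<not> W y"
      with elim have "AE x in A \<Otimes>\<^sub>M B. joint \<pi> y x = 0" by simp
      then have "(\<integral>\<^sup>+ x. joint \<pi> y x \<partial>(A \<Otimes>\<^sub>M B)) = 0"
        by (subst nn_integral_0_iff_AE) auto
      with \<open>0 < marginal \<pi> y\<close> show False
        by (simp add: nn_integral_joint[OF assms(1) y])
    qed
  qed
qed

text \<open>\<open>F\<close> is only almost everywhere equal to a measurable function, so its inner
  integral may fail to be measurable in \<open>y\<close>. \<open>\<Phi>\<close> is a measurable
  version of it, built from \<open>G\<close>.\<close>

lemma nn_integral_law: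
  fixes h :: "ereal \<Rightarrow> ennreal"
  assumes [measurable]: "\<pi> \<in> borel_measurable A" "h \<in> borel_measurable borel"
    and G[measurable]: "G \<in> borel_measurable (law \<pi>)" and FG: "AE w in law \<pi>. F w = G w"
  obtains \<Phi> where "\<Phi> \<in> borel_measurable Y" "(\<integral>\<^sup>+ w. h (F w) \<partial>law \<pi>) = (\<integral>\<^sup>+ y. \<Phi> y \<partial>Y)"
    "AE y in Y. \<Phi> y = (\<integral>\<^sup>+ (z, z'). joint \<pi> y (z, z') * h (F (z, z', y)) \<partial>(A \<Otimes>\<^sub>M B))"
proof
  have [measurable]: "G \<in> borel_measurable (A \<Otimes>\<^sub>M B \<Otimes>\<^sub>M Y)"
    using G by simp
  let ?\<Phi> = "\<lambda>y. \<integral>\<^sup>+ (z, z'). joint \<pi> y (z, z') * h (G (z, z', y)) \<partial>(A \<Otimes>\<^sub>M B)"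
  show "?\<Phi> \<in> borel_measurable Y"
    unfolding joint_def by measurable
  have "(\<integral>\<^sup>+ w. h (F w) \<partial>law \<pi>) = (\<integral>\<^sup>+ w. h (G w) \<partial>law \<pi>)"
    using FG by (intro nn_integral_cong_AE) auto
  also have "\<dots> = (\<integral>\<^sup>+ w. (\<lambda>(z, z', y). joint \<pi> y (z, z')) w * h (G w) \<partial>(A \<Otimes>\<^sub>M B \<Otimes>\<^sub>M Y))"
    unfolding law_def by (intro nn_integral_density) auto
  also have "\<dots> = (\<integral>\<^sup>+ y. ?\<Phi> y \<partial>Y)"
    by (subst nn_integral_disintegrate) simp_all
  finally show "(\<integral>\<^sup>+ w. h (F w) \<partial>law \<pi>) = (\<integral>\<^sup>+ y. ?\<Phi> y \<partial>Y)" .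
  have "AE w in A \<Otimes>\<^sub>M B \<Otimes>\<^sub>M Y. 0 < joint \<pi> (snd (snd w)) (fst w, fst (snd w)) \<longrightarrow> F w = G w"
    using FG by (simp add: AE_law)
  from AE_disintegrate[OF this]
  show "AE y in Y. ?\<Phi> y = (\<integral>\<^sup>+ (z, z'). joint \<pi> y (z, z') * h (F (z, z', y)) \<partial>(A \<Otimes>\<^sub>M B))"
  proof eventually_elim
    case (elim y)
    show ?case
    proof (rule nn_integral_cong_AE, use elim in eventually_elim)
      case (elim x)
      then show ?case
        \<comment> \<open>\<open>F\<close> and \<open>G\<close> are known to agree only where the
          joint density is positive; elsewhere both products are 0.\<close>
        by (cases "joint \<pi> y x = 0") (auto simp: case_prod_beta' zero_less_iff_neq_zero)
    qed
  qed
qed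

section \<open>The expectation of one stage and its concavity\<close>

definition stage_value :: "('a \<Rightarrow> ennreal) \<Rightarrow> ('y \<Rightarrow> ereal) \<Rightarrow> ereal" where
  "stage_value \<pi> v = ereal_integral (law \<pi>) (\<lambda>(z, z', y). ereal (c z z') + v y)"

definition stage_exists :: "('a \<Rightarrow> ennreal) \<Rightarrow> ('y \<Rightarrow> ereal) \<Rightarrow> bool" where
  "stage_exists \<pi> v \<longleftrightarrow> ereal_integral_exists (law \<pi>) (\<lambda>(z, z', y). ereal (c z z') + v y)"

text \<open>Measurable versions \<open>P\<close> and \<open>N\<close> of the positive and negative
  parts at each observation are produced so that their integrals over \<open>y\<close> may be added
  and scaled.\<close>

lemma stage_disintegrate:
  assumes [measurable]: "\<pi> \<in> borel_measurable A" and ex: "stage_exists \<pi> v"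
  obtains P N where "P \<in> borel_measurable Y" "N \<in> borel_measurable Y"
    "(\<integral>\<^sup>+ y. P y \<partial>Y) < \<infinity> \<or> (\<integral>\<^sup>+ y. N y \<partial>Y) < \<infinity>"
    "stage_value \<pi> v = enn2ereal (\<integral>\<^sup>+ y. P y \<partial>Y) - enn2ereal (\<integral>\<^sup>+ y. N y \<partial>Y)"
    "AE y in Y. P y = (\<integral>\<^sup>+ x. joint \<pi> y x * e2ennreal (ereal (c (fst x) (snd x)) + v y) \<partial>(A \<Otimes>\<^sub>M B))"
    "AE y in Y. N y = (\<integral>\<^sup>+ x. joint \<pi> y x * e2ennreal (- (ereal (c (fst x) (snd x)) + v y)) \<partial>(A \<Otimes>\<^sub>M B))"
proof -
  let ?F = "\<lambda>(z, z', y). ereal (c z z') + v y"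
  obtain G where G: "G \<in> borel_measurable (law \<pi>)" "AE w in law \<pi>. ?F w = G w"
    using ex unfolding stage_exists_def ereal_integral_exists_def by blast
  obtain P where P: "P \<in> borel_measurable Y" "(\<integral>\<^sup>+ w. e2ennreal (?F w) \<partial>law \<pi>) = (\<integral>\<^sup>+ y. P y \<partial>Y)"
    "AE y in Y. P y = (\<integral>\<^sup>+ (z, z'). joint \<pi> y (z, z') * e2ennreal (?F (z, z', y)) \<partial>(A \<Otimes>\<^sub>M B))"
    by (rule nn_integral_law[OF assms(1) measurable_e2ennreal G])
  have m: "(\<lambda>r::ereal. e2ennreal (- r)) \<in> borel_measurable borel" by measurable
  obtain N where N: "N \<in> borel_measurable Y" "(\<integral>\<^sup>+ w. e2ennreal (- ?F w) \<partial>law \<pi>) = (\<integral>\<^sup>+ y. N y \<partial>Y)"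
    "AE y in Y. N y = (\<integral>\<^sup>+ (z, z'). joint \<pi> y (z, z') * e2ennreal (- ?F (z, z', y)) \<partial>(A \<Otimes>\<^sub>M B))"
    by (rule nn_integral_law[OF assms(1) m G])
  show thesis
    using P(3) N(3) ex
    by (intro that[OF P(1) N(1)])
      (auto simp: stage_value_def stage_exists_def ereal_integral_exists_def ereal_integral_def
        P(2)[symmetric] N(2)[symmetric] case_prod_beta')
qed

text \<open>\<open>Wp\<close>, \<open>Wr\<close> and \<open>Wm\<close> stand for properties known
  only almost surely under the three laws, later well-posedness of the posteriors. Where both
  marginals are positive and finite, \<open>v\<close> may rely on all three; \<open>v0\<close>
  covers observations seen by one density only.\<close>

lemma stage_value_mixture:
  assumes [measurable]: "\<pi> \<in> borel_measurable A" "\<rho> \<in> borel_measurable A"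
    and prob: "(\<integral>\<^sup>+ z. \<pi> z \<partial>A) = 1" "(\<integral>\<^sup>+ z. \<rho> z \<partial>A) = 1"
    and a: "0 < a" "a < 1"
    and ex: "stage_exists \<pi> vp" "stage_exists \<rho> vr" "stage_exists (mixture a \<pi> \<rho>) vm"
    and W: "AE (z, z', y) in law \<pi>. Wp y" "AE (z, z', y) in law \<rho>. Wr y"
      "AE (z, z', y) in law (mixture a \<pi> \<rho>). Wm y"
    and v: "\<And>y d e. y \<in> space Y \<Longrightarrow> marginal \<pi> y = ennreal d \<Longrightarrow> 0 < d \<Longrightarrow>
        marginal \<rho> y = ennreal e \<Longrightarrow> 0 < e \<Longrightarrow> Wp y \<Longrightarrow> Wr y \<Longrightarrow> Wm y \<Longrightarrow>
        vp y \<noteq> -\<infinity> \<Longrightarrow> vr y \<noteq> -\<infinity> \<Longrightarrow>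
        ereal (a * d / (a * d + (1 - a) * e)) * vp y +
        ereal (1 - a * d / (a * d + (1 - a) * e)) * vr y \<le> vm y"
    and v0: "\<And>y d. y \<in> space Y \<Longrightarrow> marginal \<pi> y = ennreal d \<Longrightarrow> 0 < d \<Longrightarrow> marginal \<rho> y = 0 \<Longrightarrow> vm y = vp y"
      "\<And>y e. y \<in> space Y \<Longrightarrow> marginal \<pi> y = 0 \<Longrightarrow> marginal \<rho> y = ennreal e \<Longrightarrow> 0 < e \<Longrightarrow> vm y = vr y"
    and fin: "stage_value \<pi> vp \<noteq> -\<infinity>" "stage_value \<rho> vr \<noteq> -\<infinity>"
  shows "ereal a * stage_value \<pi> vp + ereal (1 - a) * stage_value \<rho> vr
    \<le> stage_value (mixture a \<pi> \<rho>) vm"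
proof -
  let ?m = "mixture a \<pi> \<rho>"
  have [measurable]: "?m \<in> borel_measurable A" by simp
  obtain Pp Np where [measurable]: "Pp \<in> borel_measurable Y" "Np \<in> borel_measurable Y" and
    p: "(\<integral>\<^sup>+ y. Pp y \<partial>Y) < \<infinity> \<or> (\<integral>\<^sup>+ y. Np y \<partial>Y) < \<infinity>"
    "stage_value \<pi> vp = enn2ereal (\<integral>\<^sup>+ y. Pp y \<partial>Y) - enn2ereal (\<integral>\<^sup>+ y. Np y \<partial>Y)"
    "AE y in Y. Pp y = (\<integral>\<^sup>+ x. joint \<pi> y x * e2ennreal (ereal (c (fst x) (snd x)) + vp y) \<partial>(A \<Otimes>\<^sub>M B))"
    "AE y in Y. Np y = (\<integral>\<^sup>+ x. joint \<pi> y x * e2ennreal (- (ereal (c (fst x) (snd x)) + vp y)) \<partial>(A \<Otimes>\<^sub>M B))"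
    by (rule stage_disintegrate[OF _ ex(1)]) simp
  obtain Pr Nr where [measurable]: "Pr \<in> borel_measurable Y" "Nr \<in> borel_measurable Y" and
    r: "(\<integral>\<^sup>+ y. Pr y \<partial>Y) < \<infinity> \<or> (\<integral>\<^sup>+ y. Nr y \<partial>Y) < \<infinity>"
    "stage_value \<rho> vr = enn2ereal (\<integral>\<^sup>+ y. Pr y \<partial>Y) - enn2ereal (\<integral>\<^sup>+ y. Nr y \<partial>Y)"
    "AE y in Y. Pr y = (\<integral>\<^sup>+ x. joint \<rho> y x * e2ennreal (ereal (c (fst x) (snd x)) + vr y) \<partial>(A \<Otimes>\<^sub>M B))"
    "AE y in Y. Nr y = (\<integral>\<^sup>+ x. joint \<rho> y x * e2ennreal (- (ereal (c (fst x) (snd x)) + vr y)) \<partial>(A \<Otimes>\<^sub>M B))"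
    by (rule stage_disintegrate[OF _ ex(2)]) simp
  obtain Pm Nm where [measurable]: "Pm \<in> borel_measurable Y" "Nm \<in> borel_measurable Y" and
    m: "(\<integral>\<^sup>+ y. Pm y \<partial>Y) < \<infinity> \<or> (\<integral>\<^sup>+ y. Nm y \<partial>Y) < \<infinity>"
    "stage_value ?m vm = enn2ereal (\<integral>\<^sup>+ y. Pm y \<partial>Y) - enn2ereal (\<integral>\<^sup>+ y. Nm y \<partial>Y)"
    "AE y in Y. Pm y = (\<integral>\<^sup>+ x. joint ?m y x * e2ennreal (ereal (c (fst x) (snd x)) + vm y) \<partial>(A \<Otimes>\<^sub>M B))"
    "AE y in Y. Nm y = (\<integral>\<^sup>+ x. joint ?m y x * e2ennreal (- (ereal (c (fst x) (snd x)) + vm y)) \<partial>(A \<Otimes>\<^sub>M B))"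
    by (rule stage_disintegrate[OF _ ex(3)]) simp
  \<comment> \<open>Were \<open>N\<close> infinite, existence would make \<open>P\<close> finite and
    the difference \<open>-\<infinity>\<close>.\<close>
  have Nfin: "N < \<infinity>" if "P < \<infinity> \<or> N < \<infinity>" "e = enn2ereal P - enn2ereal N" "e \<noteq> -\<infinity>" for P N e
    using that by (cases P; cases N) auto
  have N: "(\<integral>\<^sup>+ y. Np y \<partial>Y) < \<infinity>" "(\<integral>\<^sup>+ y. Nr y \<partial>Y) < \<infinity>"
    using Nfin[OF p(1,2) fin(1)] Nfin[OF r(1,2) fin(2)] by auto
  have Nae: "AE y in Y. Np y \<noteq> \<infinity>" "AE y in Y. Nr y \<noteq> \<infinity>"
    by (rule nn_integral_PInf_AE, simp, use N in simp)+
  have mae: "AE y in Y. marginal \<pi> y \<noteq> \<infinity>" "AE y in Y. marginal \<rho> y \<noteq> \<infinity>"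
    by (rule nn_integral_PInf_AE, simp, simp add: nn_integral_marginal prob)+
  have Wae: "AE y in Y. 0 < marginal \<pi> y \<longrightarrow> Wp y" "AE y in Y. 0 < marginal \<rho> y \<longrightarrow> Wr y"
    "AE y in Y. 0 < marginal ?m y \<longrightarrow> Wm y"
    by (rule AE_law_obs, simp, rule W)+
  have "AE y in Y. y \<in> space Y" by simp
  with Nae mae p(3,4) r(3,4) m(3,4) Wae
  have "AE y in Y. Nm y + (ennreal a * Pp y + ennreal (1 - a) * Pr y)
      \<le> Pm y + (ennreal a * Np y + ennreal (1 - a) * Nr y)"
  proof eventually_elim
    case (elim y)
    then have y[measurable]: "y \<in> space Y" by simp
    obtain d e where d: "marginal \<pi> y = ennreal d" "0 \<le> d" and e: "marginal \<rho> y = ennreal e" "0 \<le> e"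
      using elim(3,4) by (cases "marginal \<pi> y"; cases "marginal \<rho> y") auto
    have dm: "marginal ?m y = ennreal (a * d + (1 - a) * e)"
      using a d e
      by (subst marginal_mixture[OF assms(1,2) y]) (simp add: mixture_def flip: ennreal_mult ennreal_plus)
    \<comment> \<open>Positive \<open>d\<close> and \<open>e\<close> make all three marginals
      positive, the mixture's by \<open>dm\<close>.\<close>
    have W': "Wp y" "Wr y" "Wm y" if "0 < d" "0 < e"
      using elim that a by (auto simp: d e dm add_pos_pos)
    show ?case
      unfolding elim(5-10) joint_mixture
    proof (rule mixture_shift[where dp = d and dr = e])
      show "joint \<pi> y \<in> borel_measurable (A \<Otimes>\<^sub>M B)" "joint \<rho> y \<in> borel_measurable (A \<Otimes>\<^sub>M B)"
        "(\<lambda>x. c (fst x) (snd x)) \<in> borel_measurable (A \<Otimes>\<^sub>M B)"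
        by simp_all
      show "integral\<^sup>N (A \<Otimes>\<^sub>M B) (joint \<pi> y) = ennreal d" "integral\<^sup>N (A \<Otimes>\<^sub>M B) (joint \<rho> y) = ennreal e"
        by (simp_all only: nn_integral_joint[OF _ y] assms(1,2) d e)
    qed (use a d e elim W' v[OF y d(1) _ e(1)] v0(1)[OF y d(1)] v0(2)[OF y _ e(1)] in
        \<open>auto simp: top.not_eq_extremum\<close>)
  qed
  then have "(\<integral>\<^sup>+ y. Nm y + (ennreal a * Pp y + ennreal (1 - a) * Pr y) \<partial>Y)
      \<le> (\<integral>\<^sup>+ y. Pm y + (ennreal a * Np y + ennreal (1 - a) * Nr y) \<partial>Y)"
    by (rule nn_integral_mono_AE)
  then show ?thesis
    unfolding p(2) r(2) m(2)
    by (intro ereal_mixture_le_diff[OF a N m(1)]) (simp add: nn_integral_add nn_integral_cmult)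
qed

end

section \<open>Concavity of the value functions\<close>

lemma sigma_finite_PiM:
  assumes "finite I" and "\<And>i. i \<in> I \<Longrightarrow> sigma_finite_measure (M i)"
  shows "sigma_finite_measure (Pi\<^sub>M I M)"
proof -
  \<comment> \<open>\<open>product_sigma_finite\<close> speaks of every index, so factors outside
    \<open>I\<close> are replaced by the measure on the empty space; the product over
    \<open>I\<close> is unchanged.\<close>
  define M' where "M' i = (if i \<in> I then M i else count_space {})" for i
  have "sigma_finite_measure (M' i)" for i
    by (cases "i \<in> I") (simp_all add: M'_def assms(2) sigma_finite_measure_count_space_finite)
  then interpret product_sigma_finite M'
    by (rule product_sigma_finite.intro)
  have "Pi\<^sub>M I M = Pi\<^sub>M I M'"
    by (rule PiM_cong) (auto simp: M'_def)
  then show ?thesis using sigma_finite[OF assms(1)] by simp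
qed

text \<open>Evaluate the distribution on the whole space. This gives the total mass one required of
  both kernels.\<close>

lemma nn_integral_distributed:
  assumes "prob_space M" "distributed M N X f"
  shows "(\<integral>\<^sup>+ x. f x \<partial>N) = 1"
proof -
  have "(\<integral>\<^sup>+ x. f x \<partial>N) = (\<integral>\<^sup>+ x. f x * indicator (space N) x \<partial>N)"
    by (intro nn_integral_cong) simp
  also have "\<dots> = emeasure M (X -` space N \<inter> space M)"
    by (rule distributed_emeasure[OF assms(2) sets.top, symmetric])
  also have "X -` space N \<inter> space M = space M"
    using measurable_space[OF distributed_measurable[OF assms(2)]] by auto
  finally show ?thesis using prob_space.emeasure_space_1[OF assms(1)] by simp
qed

section \<open>The coupled system as an instance, and induction over time\<close>

context cps_model
begin

lemma sigma_finite_pair_sp: "t \<le> horizon S \<Longrightarrow> sigma_finite_measure (pair_sp S t)"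
  unfolding pair_sp_def
  by (intro sigma_finite_pair_measure state_sigma_finite)

lemma bayes_step_cps:
  assumes t: "t < horizon S" and u: "u \<in> space (joint_ctrl_sp S t)"
  shows "bayes_step (pair_sp S t) (pair_sp S (Suc t)) (joint_obs_sp S)
    (\<lambda>z z'. trans_dens S t (fst z) (snd z) u (fst z') (snd z'))
    (\<lambda>z' y. obs_dens S (Suc t) (fst z') y)
    (\<lambda>z z'. cost S t (fst z) u + scaling S * (norm (fst z' - snd z'))\<^sup>2)"
proof (intro bayes_step.intro bayes_step_axioms.intro)
  have t': "t \<le> horizon S" "Suc t \<le> horizon S" using t by auto
  show "sigma_finite_measure (pair_sp S t)" "sigma_finite_measure (pair_sp S (Suc t))"
    using t' by (auto intro: sigma_finite_pair_sp)
  show "sigma_finite_measure (joint_obs_sp S)"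
    unfolding joint_obs_sp_def by (intro sigma_finite_PiM obs_sigma_finite) auto
  have fst[measurable]: "fst \<in> measurable (pair_sp S s) (state_sp S s)" for s
    by (simp add: pair_sp_def)
  have [measurable]: "(\<lambda>w. (fst w, u, snd w)) \<in> measurable (pair_sp S t \<Otimes>\<^sub>M pair_sp S (Suc t))
      (pair_sp S t \<Otimes>\<^sub>M joint_ctrl_sp S t \<Otimes>\<^sub>M pair_sp S (Suc t))"
    using u by measurable
  show "(\<lambda>(z, z'). trans_dens S t (fst z) (snd z) u (fst z') (snd z'))
      \<in> borel_measurable (pair_sp S t \<Otimes>\<^sub>M pair_sp S (Suc t))"
    using measurable_compose[OF _ trans_dens_measurable[OF t], of "\<lambda>w. (fst w, u, snd w)"]
    by (simp add: case_prod_beta')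
  have "(\<lambda>w. (fst (fst w), snd w)) \<in> measurable (pair_sp S (Suc t) \<Otimes>\<^sub>M joint_obs_sp S)
      (state_sp S (Suc t) \<Otimes>\<^sub>M joint_obs_sp S)"
    by measurable
  from measurable_compose[OF this obs_dens_measurable[OF t'(2)]]
  show "(\<lambda>(z', y). obs_dens S (Suc t) (fst z') y) \<in> borel_measurable (pair_sp S (Suc t) \<Otimes>\<^sub>M joint_obs_sp S)"
    by (simp add: case_prod_beta')
  have "(\<lambda>w. (fst (fst w), u)) \<in> measurable (pair_sp S t \<Otimes>\<^sub>M pair_sp S (Suc t))
      (state_sp S t \<Otimes>\<^sub>M joint_ctrl_sp S t)"
    using u by measurable
  from measurable_compose[OF this cost_measurable[OF t]]
  have [measurable]: "(\<lambda>w. cost S t (fst (fst w)) u) \<in> borel_measurable (pair_sp S t \<Otimes>\<^sub>M pair_sp S (Suc t))"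
    by simp
  have [measurable]: "(\<lambda>z. norm (fst z - snd z)) \<in> borel_measurable (pair_sp S (Suc t))"
    using norm_measurable[OF t'(2)] by (simp add: case_prod_beta')
  show "(\<lambda>(z, z'). cost S t (fst z) u + scaling S * (norm (fst z' - snd z'))\<^sup>2)
      \<in> borel_measurable (pair_sp S t \<Otimes>\<^sub>M pair_sp S (Suc t))"
    by measurable
  show "(\<integral>\<^sup>+ z'. trans_dens S t (fst z) (snd z) u (fst z') (snd z') \<partial>pair_sp S (Suc t)) = 1"
    if "z \<in> space (pair_sp S t)" for z
    using nn_integral_distributed[OF prob_space_axioms trans_distributed[OF t _ _ u, of "fst z" "snd z"]] that
    by (auto simp: pair_sp_def space_pair_measure case_prod_beta')
  show "(\<integral>\<^sup>+ y. obs_dens S (Suc t) (fst z') y \<partial>joint_obs_sp S) = 1"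
    if "z' \<in> space (pair_sp S (Suc t))" for z'
    using nn_integral_distributed[OF prob_space_axioms obs_distributed[OF t'(2), of "fst z'"]] that
    by (auto simp: pair_sp_def space_pair_measure)
qed

text \<open>Before the horizon the density enters only through \<open>step_law\<close> and
  \<open>bayes_update\<close>, and both coincide exactly for the two densities. Hence one unfolding
  of the recursion suffices, without induction.\<close>

lemma value_fn_cong_AE:
  assumes t: "t \<le> horizon S"
    and [measurable]: "\<pi> \<in> borel_measurable (pair_sp S t)" "\<rho> \<in> borel_measurable (pair_sp S t)"
    and ae: "AE z in pair_sp S t. \<pi> z = \<rho> z"
  shows "value_fn S t \<pi> = value_fn S t \<rho>" and "well_posed S t \<pi> \<longleftrightarrow> well_posed S t \<rho>"
proof -
  have "value_fn S t \<pi> = value_fn S t \<rho> \<and> (well_posed S t \<pi> \<longleftrightarrow> well_posed S t \<rho>)"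
  proof (cases "t < horizon S")
    case True
    have eq: "step_law S t \<pi> u = step_law S t \<rho> u" "bayes_update S t \<pi> y u = bayes_update S t \<rho> y u"
      if u: "u \<in> space (joint_ctrl_sp S t)" for u y
    proof -
      interpret F: bayes_step "pair_sp S t" "pair_sp S (Suc t)" "joint_obs_sp S"
        "\<lambda>z z'. trans_dens S t (fst z) (snd z) u (fst z') (snd z')"
        "\<lambda>z' y. obs_dens S (Suc t) (fst z') y"
        "\<lambda>z z'. cost S t (fst z) u + scaling S * (norm (fst z' - snd z'))\<^sup>2"
        by (rule bayes_step_cps[OF True u])
      have "step_law S t \<sigma> u = F.law \<sigma>" "bayes_update S t \<sigma> y u = F.posterior \<sigma> y" for \<sigma>
        by (simp_all add: step_law_def F.law_def F.joint_def bayes_update_def F.posterior_def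
            F.marginal_def F.predict_def fun_eq_iff case_prod_beta')
      then show "step_law S t \<pi> u = step_law S t \<rho> u" "bayes_update S t \<pi> y u = bayes_update S t \<rho> y u"
        using F.law_cong_AE[OF assms(2,3) ae] F.posterior_cong_AE[OF ae] by simp_all
    qed
    have "value_fn S t \<pi> = value_fn S t \<rho>"
      using True by (subst (1 2) value_fn.simps) (simp add: eq cong: INF_cong)
    moreover have "well_posed S t \<pi> \<longleftrightarrow> well_posed S t \<rho>"
      unfolding well_posed.simps[of S t \<pi>] well_posed.simps[of S t \<rho>] if_P[OF True]
    proof (rule ball_cong[OF refl])
      fix u assume u: "u \<in> space (joint_ctrl_sp S t)"
      show "((AE ((x, xh), (x', xh'), y) in step_law S t \<pi> u. well_posed S (Suc t) (bayes_update S t \<pi> y u)) \<and>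
          ereal_integral_exists (step_law S t \<pi> u)
            (\<lambda>((x, xh), (x', xh'), y). ereal (cost S t x u + scaling S * (norm (x' - xh'))\<^sup>2) +
               value_fn S (Suc t) (bayes_update S t \<pi> y u))) \<longleftrightarrow>
        ((AE ((x, xh), (x', xh'), y) in step_law S t \<rho> u. well_posed S (Suc t) (bayes_update S t \<rho> y u)) \<and>
          ereal_integral_exists (step_law S t \<rho> u)
            (\<lambda>((x, xh), (x', xh'), y). ereal (cost S t x u + scaling S * (norm (x' - xh'))\<^sup>2) +
               value_fn S (Suc t) (bayes_update S t \<rho> y u)))"
        unfolding eq[OF u] ..
    qed
    ultimately show ?thesis by simp
  next
    case False
    then show ?thesis
      using t density_cong[OF assms(2,3) ae]
      by (subst (1 2) value_fn.simps, subst (1 2) well_posed.simps) simp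
  qed
  then show "value_fn S t \<pi> = value_fn S t \<rho>" and "well_posed S t \<pi> \<longleftrightarrow> well_posed S t \<rho>"
    by simp_all
qed

text \<open>Induction runs backwards from the horizon. The densities and the weight are generalised
  because the hypothesis is applied to posteriors with their conditional weight.\<close>

lemma value_fn_mixture:
  assumes "t \<le> horizon S" and "\<pi> \<in> info_states S t" "\<rho> \<in> info_states S t" and "0 < a" "a < 1"
    and "well_posed S t \<pi>" "well_posed S t \<rho>" "well_posed S t (mixture a \<pi> \<rho>)"
    and "value_fn S t \<pi> \<noteq> -\<infinity>" "value_fn S t \<rho> \<noteq> -\<infinity>"
  shows "ereal a * value_fn S t \<pi> + ereal (1 - a) * value_fn S t \<rho> \<le> value_fn S t (mixture a \<pi> \<rho>)"
  using assms
proof (induction t arbitrary: \<pi> \<rho> a rule: inc_induct)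
  case base
  let ?M = "pair_sp S (horizon S)"
  let ?P = "\<lambda>\<pi>. \<integral>\<^sup>+ z. \<pi> z * ennreal (final_cost S (fst z)) \<partial>?M"
  let ?N = "\<lambda>\<pi>. \<integral>\<^sup>+ z. \<pi> z * ennreal (- final_cost S (fst z)) \<partial>?M"
  have [measurable]: "(\<lambda>z. final_cost S (fst z)) \<in> borel_measurable ?M"
    using final_cost_measurable unfolding pair_sp_def by measurable
  have meas[measurable]: "\<pi> \<in> borel_measurable ?M" "\<rho> \<in> borel_measurable ?M"
    using base by (simp_all add: info_states_def)
  have meas_m[measurable]: "mixture a \<pi> \<rho> \<in> borel_measurable ?M"
    by simp
  have V: "value_fn S (horizon S) \<sigma> = enn2ereal (?P \<sigma>) - enn2ereal (?N \<sigma>)"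
    if [measurable]: "\<sigma> \<in> borel_measurable ?M" for \<sigma>
    by (subst value_fn.simps) (simp add: ereal_integral_def case_prod_beta' nn_integral_density)
  have ex: "?P \<sigma> < \<infinity> \<or> ?N \<sigma> < \<infinity>"
    if [measurable]: "\<sigma> \<in> borel_measurable ?M" and "well_posed S (horizon S) \<sigma>" for \<sigma>
    using that(2)
    by (subst (asm) well_posed.simps)
      (simp add: ereal_integral_exists_def case_prod_beta' nn_integral_density)
  have fin: "?N \<sigma> < \<infinity>" if "\<sigma> \<in> borel_measurable ?M" "well_posed S (horizon S) \<sigma>"
    "value_fn S (horizon S) \<sigma> \<noteq> -\<infinity>" for \<sigma>
    using V[OF that(1)] ex[OF that(1,2)] that(3) by (cases "?P \<sigma>"; cases "?N \<sigma>") auto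
  show ?case
    unfolding V[OF meas(1)] V[OF meas(2)] V[OF meas_m]
    \<comment> \<open>The expected final cost is linear in the density, so the inequality required
      by \<open>ereal_mixture_le_diff\<close> is an equality here.\<close>
    using base meas meas_m
    by (intro ereal_mixture_le_diff fin ex)
      (auto simp: nn_integral_mixture add.commute)
next
  case (step t)
  let ?m = "mixture a \<pi> \<rho>"
  note t = \<open>t < horizon S\<close> and a = \<open>0 < a\<close> \<open>a < 1\<close>
  have t': "Suc t \<le> horizon S" using t by simp
  have meas[measurable]: "\<pi> \<in> borel_measurable (pair_sp S t)" "\<rho> \<in> borel_measurable (pair_sp S t)"
    using step.prems by (simp_all add: info_states_def)
  have meas_m: "?m \<in> borel_measurable (pair_sp S t)"
    by simp
  have prob: "(\<integral>\<^sup>+ z. \<pi> z \<partial>pair_sp S t) = 1" "(\<integral>\<^sup>+ z. \<rho> z \<partial>pair_sp S t) = 1"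
    using step.prems by (simp_all add: info_states_def)
  define E where "E \<sigma> u = ereal_integral (step_law S t \<sigma> u)
    (\<lambda>((x, xh), (x', xh'), y). ereal (cost S t x u + scaling S * (norm (x' - xh'))\<^sup>2) +
       value_fn S (Suc t) (bayes_update S t \<sigma> y u))" for \<sigma> u
  have V: "value_fn S t \<sigma> = (INF u \<in> space (joint_ctrl_sp S t). E \<sigma> u)" for \<sigma>
    using t by (subst value_fn.simps) (simp add: E_def)
  show ?case
    unfolding V[of ?m]
  proof (rule INF_greatest)
    fix u assume u: "u \<in> space (joint_ctrl_sp S t)"
    interpret F: bayes_step "pair_sp S t" "pair_sp S (Suc t)" "joint_obs_sp S"
      "\<lambda>z z'. trans_dens S t (fst z) (snd z) u (fst z') (snd z')"
      "\<lambda>z' y. obs_dens S (Suc t) (fst z') y"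
      "\<lambda>z z'. cost S t (fst z) u + scaling S * (norm (fst z' - snd z'))\<^sup>2"
      by (rule bayes_step_cps[OF t u])
    have law: "step_law S t \<sigma> u = F.law \<sigma>" for \<sigma>
      by (simp add: step_law_def F.law_def F.joint_def case_prod_beta')
    have post: "bayes_update S t \<sigma> y u = F.posterior \<sigma> y" for \<sigma> y
      by (simp add: bayes_update_def F.posterior_def F.marginal_def F.predict_def fun_eq_iff case_prod_beta')
    let ?W = "\<lambda>\<sigma> y. well_posed S (Suc t) (F.posterior \<sigma> y)"
    let ?v = "\<lambda>\<sigma> y. value_fn S (Suc t) (F.posterior \<sigma> y)"
    have E: "E \<sigma> u = F.stage_value \<sigma> (?v \<sigma>)" for \<sigma>
      by (simp add: E_def F.stage_value_def law post case_prod_beta')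
    have wp: "AE (z, z', y) in F.law \<sigma>. well_posed S (Suc t) (F.posterior \<sigma> y)"
      "F.stage_exists \<sigma> (?v \<sigma>)" if "well_posed S t \<sigma>" for \<sigma>
      using bspec[OF that[unfolded well_posed.simps[of S t \<sigma>] if_P[OF t]] u, unfolded law post]
      by (simp_all add: F.stage_exists_def case_prod_beta')
    have le: "value_fn S t \<sigma> \<le> E \<sigma> u" for \<sigma>
      unfolding V using u by (rule INF_lower)
    have info: "F.posterior \<sigma> y \<in> info_states S (Suc t)"
      if "\<sigma> \<in> borel_measurable (pair_sp S t)" "y \<in> space (joint_obs_sp S)"
        "F.marginal \<sigma> y = ennreal d" "0 < d" for \<sigma> y d
      using that F.measurable_posterior[of \<sigma> y] F.nn_integral_posterior[of \<sigma> y]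
      by (simp add: info_states_def)
    \<comment> \<open>The infimum for \<open>?m\<close> is tested one control at a time, and the
      same control bounds both values on the left from above.\<close>
    have "ereal a * value_fn S t \<pi> + ereal (1 - a) * value_fn S t \<rho> \<le> ereal a * E \<pi> u + ereal (1 - a) * E \<rho> u"
      using step.prems le by (intro add_mono ereal_mult_left_mono) auto
    also have "\<dots> \<le> E ?m u"
      unfolding E
    proof (rule F.stage_value_mixture[where Wp = "?W \<pi>" and Wr = "?W \<rho>" and Wm = "?W ?m"])
      fix y d
      assume y: "y \<in> space (joint_obs_sp S)" and d: "F.marginal \<pi> y = ennreal d" "0 < d"
      show "?v ?m y = ?v \<pi> y" if "F.marginal \<rho> y = 0"
        by (rule value_fn_cong_AE[OF t' _ _ F.posterior_mixture_null[OF meas(1,2) y a d that]])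
          (use y meas meas_m in \<open>auto intro: F.measurable_posterior\<close>)
      fix e
      assume e: "F.marginal \<rho> y = ennreal e" "0 < e"
        and W: "?W \<pi> y" "?W \<rho> y" "?W ?m y" and fin: "?v \<pi> y \<noteq> -\<infinity>" "?v \<rho> y \<noteq> -\<infinity>"
      define l where "l = a * d / (a * d + (1 - a) * e)"
      have l: "0 < l" "l < 1"
        using a d e by (simp_all add: l_def divide_less_eq add_pos_pos)
      have eq: "AE z' in pair_sp S (Suc t). F.posterior ?m y z' =
          mixture l (F.posterior \<pi> y) (F.posterior \<rho> y) z'"
        using F.posterior_mixture[OF meas(1,2) y _ a d e] by (auto simp: l_def)
      note [measurable] = F.measurable_posterior[OF meas(1) y] F.measurable_posterior[OF meas(2) y]
      \<comment> \<open>Value and well-posedness pass from the posterior of \<open>?m\<close> to the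
        explicit mixture of posteriors, the form to which the induction hypothesis applies.\<close>
      have cong: "?v ?m y = value_fn S (Suc t) (mixture l (F.posterior \<pi> y) (F.posterior \<rho> y))"
        "?W ?m y \<longleftrightarrow> well_posed S (Suc t) (mixture l (F.posterior \<pi> y) (F.posterior \<rho> y))"
        by (rule value_fn_cong_AE[OF t' F.measurable_posterior[OF meas_m y] _ eq], simp)+
      show "ereal (a * d / (a * d + (1 - a) * e)) * ?v \<pi> y +
        ereal (1 - a * d / (a * d + (1 - a) * e)) * ?v \<rho> y \<le> ?v ?m y"
        unfolding l_def[symmetric] cong(1)
        using W fin l info[OF meas(1) y d] info[OF meas(2) y e] unfolding cong(2)
        by (intro step.IH)
    next
      fix y e
      assume y: "y \<in> space (joint_obs_sp S)" and d: "F.marginal \<pi> y = 0" "F.marginal \<rho> y = ennreal e" "0 < e"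
      \<comment> \<open>\<open>posterior_mixture_null\<close> treats a vanishing second marginal, so
        the densities are exchanged and the weight becomes \<open>1 - a\<close>.\<close>
      have a': "0 < 1 - a" "1 - a < 1" using a by auto
      show "?v ?m y = ?v \<rho> y"
        unfolding mixture_commute[of a]
        by (rule value_fn_cong_AE[OF t' _ _ F.posterior_mixture_null[OF meas(2,1) y a' d(2,3,1)]])
          (use y meas meas_m in \<open>auto intro: F.measurable_posterior\<close>)
    qed (use step.prems prob wp le[of \<pi>] le[of \<rho>] in \<open>auto simp: E\<close>)
    finally show "ereal a * value_fn S t \<pi> + ereal (1 - a) * value_fn S t \<rho> \<le> E ?m u" .
  qed
qed

end

theorem theorem4:
  fixes S :: "('s, 'x :: real_normed_vector, 'u, 'y, 'w, 'z) cps"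
    and t :: nat
    and D :: "('x \<times> 'x \<Rightarrow> ennreal) set"
  assumes "cps_model S"
    and "t \<le> horizon S"
    and "D \<subseteq> info_states S t"
    and "convex_densities D"
    and "\<forall>\<pi> \<in> D. well_posed S t \<pi>"
  shows "concave_on_densities D (value_fn S t)"
  unfolding concave_on_densities_def
proof (intro conjI ballI impI)
  show "convex_densities D" by fact
next
  fix \<pi> \<rho> and a :: real
  assume D: "\<pi> \<in> D" "\<rho> \<in> D" and a: "a \<in> {0..1}"
    and fin: "value_fn S t \<pi> \<noteq> -\<infinity>" "value_fn S t \<rho> \<noteq> -\<infinity>"
  \<comment> \<open>At the endpoints the mixture is one of the two densities, and the other term
    vanishes even for an infinite value, as 0 times \<infinity> is 0 in
    \<open>ereal\<close>.\<close>
  consider "a = 0" | "a = 1" | "0 < a" "a < 1" using a by fastforce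
  then show "ereal a * value_fn S t \<pi> + ereal (1 - a) * value_fn S t \<rho> \<le> value_fn S t (mixture a \<pi> \<rho>)"
  proof cases
    case 3
    \<comment> \<open>Membership in \<open>D\<close> supplies well-posedness at the mixture.\<close>
    have "mixture a \<pi> \<rho> \<in> D"
      using D a assms(4) by (auto simp: convex_densities_def)
    with 3 D fin show ?thesis
      using assms(2,3,5) by (intro cps_model.value_fn_mixture[OF assms(1)]) auto
  qed (simp_all add: mixture_def flip: zero_ereal_def)
qed

end
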